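(* Let $(M,g,\xi,\lambda)$ be an $n$-dimensional connected Yamabe soliton with $n>2$ and scalar curvature $R$. Suppose that: (i) the soliton field $\xi$ annihilates the Hessian operator $A_R$ of $R$, i.e. $A_R(\xi)=0$; (ii) $\Delta\xi=-\mu\,\xi$ for a positive constant $\mu$; (iii) the Ricci curvature in the direction of the soliton field is a constant, i.e. there is a constant $\nu\in\mathbb{R}$ with $\mathrm{Ric}(\xi,\xi)=\nu\|\xi\|^2$ on $M$. Then $g$ is a Yamabe metric, i.e. $R$ is constant on $M$.
   Context: A Yamabe soliton $(M,g,\xi,\lambda)$ is a connected smooth Riemannian manifold $(M,g)$ together with a smooth vector field $\xi$ (the soliton field) and a constant $\lambda\in\mathbb{R}$ such that $\frac12\mathcal{L}_\xi g=(R-\lambda)g$, where $\mathcal{L}_\xi$ is the Lie derivative and $R$ is the scalar curvature of $g$. No compactness or completeness is assumed. The metric $g$ is called a Yamabe metric if $R$ is constant. $\mathrm{Ric}$ is the Ricci tensor and $\nabla$ the Levi-Civita connection. The Hessian operator of a smooth function $f$ is $A_f(X)=\nabla_X(\nabla f)$, where $\nabla f$ is the gradient of $f$. The Laplace operator on smooth vector fields is $\Delta X=\sum_{i=1}^n\left(\nabla_{e_i}\nabla_{e_i}X-\nabla_{\nabla_{e_i}e_i}X\right)$ for a local orthonormal frame $\{e_1,\dots,e_n\}$. *)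

theory Defs
  imports "HOL-Analysis.Analysis"
begin

section \<open>Smooth maps between normed spaces\<close>

text \<open>On open subsets of a finite-dimensional space this is the usual notion of class
  \<open>C\<^sup>k\<close> and \<open>C\<^sup>\<infinity>\<close>: all iterated directional derivatives exist and are continuous.
  It is only used on open sets.\<close>

primrec Ck_on :: "nat \<Rightarrow> 'v::real_normed_vector set \<Rightarrow> ('v \<Rightarrow> 'w::real_normed_vector) \<Rightarrow> bool" where
  "Ck_on 0 S f \<longleftrightarrow> continuous_on S f"
| "Ck_on (Suc k) S f \<longleftrightarrow>
     (\<forall>x\<in>S. f differentiable (at x)) \<and> (\<forall>v. Ck_on k S (\<lambda>x. frechet_derivative f (at x) v))"

definition smooth_on :: "'v::real_normed_vector set \<Rightarrow> ('v \<Rightarrow> 'w::real_normed_vector) \<Rightarrow> bool" where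
  "smooth_on S f \<longleftrightarrow> (\<forall>k. Ck_on k S f)"


section \<open>Smooth manifolds\<close>

type_synonym ('a, 'n) chart = "'a set \<times> ('a \<Rightarrow> real^'n)"

record ('a, 'n) mfd =
  mtop :: "'a topology"
  atlas :: "('a, 'n) chart set"

abbreviation points :: "('a, 'n::finite) mfd \<Rightarrow> 'a set" where
  "points M \<equiv> topspace (mtop M)"

abbreviation chart_dom :: "('a, 'n::finite) chart \<Rightarrow> 'a set" where
  "chart_dom c \<equiv> fst c"

abbreviation coord :: "('a, 'n::finite) chart \<Rightarrow> 'a \<Rightarrow> real^'n" where
  "coord c \<equiv> snd c"

definition param :: "('a, 'n::finite) chart \<Rightarrow> real^'n \<Rightarrow> 'a" where
  "param c = inv_into (chart_dom c) (coord c)"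

definition is_chart :: "'a topology \<Rightarrow> ('a, 'n::finite) chart \<Rightarrow> bool" where
  "is_chart T c \<longleftrightarrow> openin T (chart_dom c) \<and> open (coord c ` chart_dom c) \<and>
     homeomorphic_map (subtopology T (chart_dom c)) (top_of_set (coord c ` chart_dom c)) (coord c)"

definition smooth_manifold :: "('a, 'n::finite) mfd \<Rightarrow> bool" where
  "smooth_manifold M \<longleftrightarrow>
     Hausdorff_space (mtop M) \<and> second_countable (mtop M) \<and>
     (\<forall>c\<in>atlas M. is_chart (mtop M) c) \<and>
     (\<Union>c\<in>atlas M. chart_dom c) = points M \<and>
     (\<forall>c\<in>atlas M. \<forall>d\<in>atlas M. smooth_on (coord c ` (chart_dom c \<inter> chart_dom d)) (coord d \<circ> param c))"

definition smooth_fun :: "('a, 'n::finite) mfd \<Rightarrow> 'a set \<Rightarrow> ('a \<Rightarrow> real) \<Rightarrow> bool" where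
  "smooth_fun M U f \<longleftrightarrow> (\<forall>c\<in>atlas M. smooth_on (coord c ` (chart_dom c \<inter> U)) (f \<circ> param c))"


section \<open>Tangent vectors and vector fields\<close>

text \<open>A tangent vector at \<open>p\<close> is a class of pairs (chart \<open>c\<close> around \<open>p\<close>, vector \<open>v\<close>), where
  \<open>(c, v)\<close> and \<open>(d, w)\<close> are identified iff \<open>w\<close> is the image of \<open>v\<close> under the derivative
  of the transition map from \<open>c\<close> to \<open>d\<close>.  Each class has exactly one representative
  belonging to the chart \<open>chart_at M p\<close>, and the class is encoded by the vector of this
  representative.  Thus the type \<open>real^'n\<close> serves as tangent space at every point,
  and \<open>components M c p v\<close> recovers the components of \<open>v\<close> in any other chart \<open>c\<close> around \<open>p\<close>.
  The dependence of \<open>chart_at M p\<close> on \<open>p\<close> is arbitrary, so differentiation of a vector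
  field \<open>X\<close> must always go through the components \<open>components M c p (X p)\<close> in one fixed chart.\<close>

definition chart_at :: "('a, 'n::finite) mfd \<Rightarrow> 'a \<Rightarrow> ('a, 'n) chart" where
  "chart_at M p = (SOME c. c \<in> atlas M \<and> p \<in> chart_dom c)"

definition components :: "('a, 'n::finite) mfd \<Rightarrow> ('a, 'n) chart \<Rightarrow> 'a \<Rightarrow> real^'n \<Rightarrow> real^'n" where
  "components M c p v =
     frechet_derivative (coord c \<circ> param (chart_at M p)) (at (coord (chart_at M p) p)) v"

type_synonym ('a, 'n) field = "'a \<Rightarrow> real^'n"

text \<open>Fields and functions are total, but only their values on the open set \<open>U\<close> matter when
  they are regarded as local fields and functions on \<open>U\<close>.\<close>

definition component_field :: "('a, 'n::finite) mfd \<Rightarrow> ('a, 'n) field \<Rightarrow> ('a, 'n) chart \<Rightarrow> real^'n \<Rightarrow> real^'n"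
  where "component_field M X c = (\<lambda>p. components M c p (X p)) \<circ> param c"

definition smooth_field :: "('a, 'n::finite) mfd \<Rightarrow> 'a set \<Rightarrow> ('a, 'n) field \<Rightarrow> bool" where
  "smooth_field M U X \<longleftrightarrow> (\<forall>c\<in>atlas M. smooth_on (coord c ` (chart_dom c \<inter> U)) (component_field M X c))"

definition vec_deriv :: "('a, 'n::finite) mfd \<Rightarrow> 'a \<Rightarrow> real^'n \<Rightarrow> ('a \<Rightarrow> real) \<Rightarrow> real" where
  "vec_deriv M p v f = frechet_derivative (f \<circ> param (chart_at M p)) (at (coord (chart_at M p) p)) v"

definition field_deriv :: "('a, 'n::finite) mfd \<Rightarrow> ('a, 'n) field \<Rightarrow> ('a \<Rightarrow> real) \<Rightarrow> 'a \<Rightarrow> real" where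
  "field_deriv M X f p = vec_deriv M p (X p) f"

text \<open>\<open>[X, Y]\<^sup>k = X\<^sup>i \<partial>\<^sub>i Y\<^sup>k - Y\<^sup>i \<partial>\<^sub>i X\<^sup>k\<close>, computed at \<open>p\<close> in the chart \<open>chart_at M p\<close>, in which
  the components of \<open>X\<close> and \<open>Y\<close> at \<open>p\<close> are just \<open>X p\<close> and \<open>Y p\<close>.\<close>

definition lie_bracket ::
  "('a, 'n::finite) mfd \<Rightarrow> ('a, 'n) field \<Rightarrow> ('a, 'n) field \<Rightarrow> ('a, 'n) field" where
  "lie_bracket M X Y p =
     (let c = chart_at M p; x = coord c p in
        frechet_derivative (component_field M Y c) (at x) (X p)
      - frechet_derivative (component_field M X c) (at x) (Y p))"


section \<open>Riemannian metrics and the Levi-Civita connection\<close>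

type_synonym ('a, 'n) metric_tensor = "'a \<Rightarrow> real^'n \<Rightarrow> real^'n \<Rightarrow> real"

type_synonym ('a, 'n) connection = "('a, 'n) field \<Rightarrow> ('a, 'n) field \<Rightarrow> ('a, 'n) field"

definition riemannian_metric :: "('a, 'n::finite) mfd \<Rightarrow> ('a, 'n) metric_tensor \<Rightarrow> bool" where
  "riemannian_metric M g \<longleftrightarrow>
     (\<forall>p\<in>points M. bilinear (g p) \<and> (\<forall>v w. g p v w = g p w v) \<and> (\<forall>v. v \<noteq> 0 \<longrightarrow> g p v v > 0)) \<and>
     (\<forall>U X Y. openin (mtop M) U \<and> smooth_field M U X \<and> smooth_field M U Y
        \<longrightarrow> smooth_fun M U (\<lambda>p. g p (X p) (Y p)))"

text \<open>The axioms are imposed for local fields over every open set, so that a connection also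
  acts on local frames.  They determine the values of \<open>nabla X Y\<close> on \<open>U\<close> from those of \<open>X\<close>
  and \<open>Y\<close> on \<open>U\<close>: if \<open>Y\<close> vanishes on \<open>U\<close>, apply the Leibniz rule to \<open>Y = f Y\<close>, where \<open>f\<close> is
  the indicator function of the complement of \<open>U\<close>.\<close>

definition affine_connection :: "('a, 'n::finite) mfd \<Rightarrow> ('a, 'n) connection \<Rightarrow> bool" where
  "affine_connection M nabla \<longleftrightarrow>
     (\<forall>U X Y Z f. openin (mtop M) U \<and> smooth_field M U X \<and> smooth_field M U Y \<and>
                  smooth_field M U Z \<and> smooth_fun M U f \<longrightarrow>
        smooth_field M U (nabla X Y) \<and>
        (\<forall>p\<in>U.
           nabla (\<lambda>q. X q + Y q) Z p = nabla X Z p + nabla Y Z p \<and>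
           nabla (\<lambda>q. f q *\<^sub>R X q) Y p = f p *\<^sub>R nabla X Y p \<and>
           nabla X (\<lambda>q. Y q + Z q) p = nabla X Y p + nabla X Z p \<and>
           nabla X (\<lambda>q. f q *\<^sub>R Y q) p = field_deriv M X f p *\<^sub>R Y p + f p *\<^sub>R nabla X Y p))"

definition levi_civita ::
  "('a, 'n::finite) mfd \<Rightarrow> ('a, 'n) metric_tensor \<Rightarrow> ('a, 'n) connection \<Rightarrow> bool" where
  "levi_civita M g nabla \<longleftrightarrow>
     affine_connection M nabla \<and>
     (\<forall>U X Y Z. openin (mtop M) U \<and> smooth_field M U X \<and> smooth_field M U Y \<and>
                smooth_field M U Z \<longrightarrow>
        (\<forall>p\<in>U.
           nabla X Y p - nabla Y X p = lie_bracket M X Y p \<and>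
           field_deriv M X (\<lambda>q. g q (Y q) (Z q)) p =
             g p (nabla X Y p) (Z p) + g p (Y p) (nabla X Z p)))"


section \<open>Orthonormal frames, curvature and the Laplace operator\<close>

definition orthonormal_frame ::
  "('a, 'n::finite) mfd \<Rightarrow> ('a, 'n) metric_tensor \<Rightarrow> 'a set \<Rightarrow> ('n \<Rightarrow> ('a, 'n) field) \<Rightarrow> bool" where
  "orthonormal_frame M g U e \<longleftrightarrow>
     openin (mtop M) U \<and> (\<forall>i. smooth_field M U (e i)) \<and>
     (\<forall>p\<in>U. \<forall>i j. g p (e i p) (e j p) = (if i = j then 1 else 0))"

definition frame_at ::
  "('a, 'n::finite) mfd \<Rightarrow> ('a, 'n) metric_tensor \<Rightarrow> 'a \<Rightarrow> 'n \<Rightarrow> ('a, 'n) field" where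
  "frame_at M g p = (SOME e. \<exists>U. p \<in> U \<and> orthonormal_frame M g U e)"

definition curvature ::
  "('a, 'n::finite) mfd \<Rightarrow> ('a, 'n) connection
     \<Rightarrow> ('a, 'n) field \<Rightarrow> ('a, 'n) field \<Rightarrow> ('a, 'n) field \<Rightarrow> ('a, 'n) field" where
  "curvature M nabla X Y Z p =
     nabla X (nabla Y Z) p - nabla Y (nabla X Z) p - nabla (lie_bracket M X Y) Z p"

text \<open>\<open>Ric(Y, Z)\<close> is the trace of \<open>X \<mapsto> R(X, Y) Z\<close>; round spheres have positive Ricci curvature.\<close>

definition ricci ::
  "('a, 'n::finite) mfd \<Rightarrow> ('a, 'n) metric_tensor \<Rightarrow> ('a, 'n) connection
     \<Rightarrow> ('a, 'n) field \<Rightarrow> ('a, 'n) field \<Rightarrow> 'a \<Rightarrow> real" where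
  "ricci M g nabla Y Z p =
     (let e = frame_at M g p in \<Sum>i\<in>UNIV. g p (curvature M nabla (e i) Y Z p) (e i p))"

definition scalar_curvature ::
  "('a, 'n::finite) mfd \<Rightarrow> ('a, 'n) metric_tensor \<Rightarrow> ('a, 'n) connection \<Rightarrow> 'a \<Rightarrow> real" where
  "scalar_curvature M g nabla p =
     (let e = frame_at M g p in \<Sum>i\<in>UNIV. ricci M g nabla (e i) (e i) p)"

definition gradient ::
  "('a, 'n::finite) mfd \<Rightarrow> ('a, 'n) metric_tensor \<Rightarrow> ('a \<Rightarrow> real) \<Rightarrow> ('a, 'n) field" where
  "gradient M g f p = (THE v. \<forall>w. g p v w = vec_deriv M p w f)"

definition hessian_operator ::
  "('a, 'n::finite) mfd \<Rightarrow> ('a, 'n) metric_tensor \<Rightarrow> ('a, 'n) connection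
     \<Rightarrow> ('a \<Rightarrow> real) \<Rightarrow> ('a, 'n) field \<Rightarrow> ('a, 'n) field" where
  "hessian_operator M g nabla f X = nabla X (gradient M g f)"

definition laplacian ::
  "('a, 'n::finite) mfd \<Rightarrow> ('a, 'n) metric_tensor \<Rightarrow> ('a, 'n) connection
     \<Rightarrow> ('a, 'n) field \<Rightarrow> ('a, 'n) field" where
  "laplacian M g nabla X p =
     (let e = frame_at M g p in
        \<Sum>i\<in>UNIV. nabla (e i) (nabla (e i) X) p - nabla (nabla (e i) (e i)) X p)"


section \<open>Yamabe solitons\<close>

definition lie_deriv_metric ::
  "('a, 'n::finite) mfd \<Rightarrow> ('a, 'n) field \<Rightarrow> ('a, 'n) metric_tensor
     \<Rightarrow> ('a, 'n) field \<Rightarrow> ('a, 'n) field \<Rightarrow> 'a \<Rightarrow> real" where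
  "lie_deriv_metric M \<xi> g X Y p =
     field_deriv M \<xi> (\<lambda>q. g q (X q) (Y q)) p
     - g p (lie_bracket M \<xi> X p) (Y p) - g p (X p) (lie_bracket M \<xi> Y p)"

text \<open>The argument \<open>nabla\<close> is required to be the Levi-Civita connection of \<open>g\<close>, which is unique
  on smooth local fields, so it carries no additional data.\<close>

definition yamabe_soliton ::
  "('a, 'n::finite) mfd \<Rightarrow> ('a, 'n) metric_tensor \<Rightarrow> ('a, 'n) connection
     \<Rightarrow> ('a, 'n) field \<Rightarrow> real \<Rightarrow> bool" where
  "yamabe_soliton M g nabla \<xi> lam \<longleftrightarrow>
     smooth_manifold M \<and> connected_space (mtop M) \<and>
     riemannian_metric M g \<and> levi_civita M g nabla \<and>
     smooth_field M (points M) \<xi> \<and>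
     (\<forall>U X Y. openin (mtop M) U \<and> smooth_field M U X \<and> smooth_field M U Y \<longrightarrow>
        (\<forall>p\<in>U. 1/2 * lie_deriv_metric M \<xi> g X Y p =
                 (scalar_curvature M g nabla p - lam) * g p (X p) (Y p)))"

definition yamabe_metric ::
  "('a, 'n::finite) mfd \<Rightarrow> ('a, 'n) metric_tensor \<Rightarrow> ('a, 'n) connection \<Rightarrow> bool" where
  "yamabe_metric M g nabla \<longleftrightarrow> scalar_curvature M g nabla constant_on points M"

end

theory Submission
  imports Defs
begin

text \<open>
Write \<open>\<sigma> = R - lam\<close>, \<open>G\<close> for the gradient of \<open>R\<close> (which is also that of \<open>\<sigma>\<close>), and
\<open>B(X, Y) = g(\<nabla>\<^bsub>X\<^esub> \<xi>, Y)\<close>.  The soliton equation says that \<open>\<xi>\<close> is conformal: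
\<open>B(X, Y) + B(Y, X) = 2 \<sigma> g(X, Y)\<close>.  For every conformal field, a Bochner type computation
(\<open>ricci_plus_laplacian\<close>) yields
\<open>Ric(\<xi>, \<xi>) + g(\<Delta> \<xi>, \<xi>) = - (n - 2) \<xi>(\<sigma>)\<close>.
Under the assumptions on the Laplacian and on the Ricci curvature this becomes
\<open>(n - 2) \<xi>(R) = (\<mu> - \<nu>) |\<xi>|\<^sup>2\<close> everywhere on the manifold.

Differentiate this identity along a field \<open>X\<close>.  Since the Hessian of \<open>R\<close> is symmetric and
annihilates \<open>\<xi>\<close>, the derivative of \<open>\<xi>(R) = g(\<xi>, G)\<close> is just \<open>B(X, G)\<close>, so
\<open>(n - 2) B(X, G) = 2 (\<mu> - \<nu>) B(X, \<xi>)\<close>.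
For \<open>X = \<xi>\<close>, where \<open>B(\<xi>, \<xi>) = \<sigma> |\<xi>|\<^sup>2\<close>, this gives \<open>B(\<xi>, G) = 2 \<sigma> \<xi>(R)\<close>, and the
conformal equation leaves \<open>B(G, \<xi>) = 0\<close>.  For \<open>X = G\<close> it therefore gives
\<open>\<sigma> |G|\<^sup>2 = B(G, G) = 0\<close> (\<open>factor_times_gradient_zero\<close>).  So \<open>\<sigma>\<^sup>2\<close> has derivative zero and is
constant on the connected manifold; either \<open>\<sigma>\<close> vanishes identically or it vanishes nowhere, and
then \<open>G = 0\<close>.

Up to the last step the argument is local, and it is carried out with smooth fields on the domain of an orthonormal
frame.  Two facts are obtained without computing curvature in coordinates.  The scalar curvature
is smooth because \<open>\<sigma> = B(E, E)\<close> for every unit field \<open>E\<close>; and the formula for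
\<open>Ric(\<xi>, \<xi>)\<close> is the sum over the frame of an identity that holds for each unit field separately
(\<open>curvature_plus_second_derivative\<close>).
\<close>

section \<open>Calculus of class C^k maps\<close>

abbreviation fd :: "('v::real_normed_vector \<Rightarrow> 'w::real_normed_vector) \<Rightarrow> 'v \<Rightarrow> 'v \<Rightarrow> 'w" where
  "fd f x \<equiv> frechet_derivative f (at x)"

lemma fd_cong:
  assumes "open S" "x \<in> S" "\<And>y. y \<in> S \<Longrightarrow> f y = h y"
  shows "fd f x = fd h x"
proof -
  have "(f has_derivative F) (at x) \<longleftrightarrow> (h has_derivative F) (at x)" for F
    using has_derivative_transform_within_open[of f F x UNIV S h]
      has_derivative_transform_within_open[of h F x UNIV S f] assms by auto
  then show ?thesis by (simp add: frechet_derivative_def)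
qed

lemma differentiable_cong_open:
  assumes "open S" "x \<in> S" "\<And>y. y \<in> S \<Longrightarrow> f y = h y" "f differentiable (at x)"
  shows "h differentiable (at x)"
  using assms has_derivative_transform_within_open[of f _ x UNIV S h]
  unfolding differentiable_def by blast

lemma Ck_on_cong:
  assumes "open S" "\<And>x. x \<in> S \<Longrightarrow> f x = h x" "Ck_on k S f"
  shows "Ck_on k S h"
  using assms(2,3)
proof (induction k arbitrary: f h)
  case 0
  then show ?case by (metis Ck_on.simps(1) continuous_on_cong)
next
  case (Suc k)
  have "fd f x = fd h x" if "x \<in> S" for x
    using fd_cong[OF assms(1) that] Suc.prems by blast
  moreover have "h differentiable (at x)" if "x \<in> S" for x
    using differentiable_cong_open[OF assms(1) that] Suc.prems that by auto
  ultimately show ?case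
    using Suc.prems Suc.IH[of "\<lambda>x. fd f x v" "\<lambda>x. fd h x v" for v] by auto
qed

lemma Ck_on_subset: "Ck_on k S f \<Longrightarrow> T \<subseteq> S \<Longrightarrow> Ck_on k T f"
  by (induction k arbitrary: f) (auto intro: continuous_on_subset)

lemma Ck_on_SucI:
  assumes "open S" "\<And>x. x \<in> S \<Longrightarrow> (f has_derivative f' x) (at x)"
    and "\<And>v. Ck_on k S (\<lambda>x. f' x v)"
  shows "Ck_on (Suc k) S f"
proof -
  have "f' x v = fd f x v" if "x \<in> S" for x v
    using frechet_derivative_at[OF assms(2)[OF that]] by simp
  then have "Ck_on k S (\<lambda>x. fd f x v)" for v
    using Ck_on_cong[OF assms(1) _ assms(3)[of v]] by auto
  then show ?thesis using assms(2) by (auto simp: differentiable_def)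
qed

lemma Ck_on_Suc_has_derivative:
  "Ck_on (Suc k) S f \<Longrightarrow> x \<in> S \<Longrightarrow> (f has_derivative fd f x) (at x)"
  using frechet_derivative_works by auto

lemma Ck_on_mono_Suc: "Ck_on (Suc k) S f \<Longrightarrow> Ck_on k S f"
proof (induction k arbitrary: f)
  case 0
  then show ?case
    using differentiable_imp_continuous_on[of f S] differentiable_at_withinI[of f _ S]
    by (simp add: differentiable_on_def)
next
  case (Suc k)
  have "Ck_on k S (\<lambda>x. fd f x v)" for v
    using Suc.prems by (intro Suc.IH) (subst (asm) Ck_on.simps(2), blast)
  moreover have "\<forall>x\<in>S. f differentiable (at x)"
    using Suc.prems by (subst (asm) Ck_on.simps(2)) blast
  ultimately show ?case by simp
qed

lemma Ck_on_const: "Ck_on k S (\<lambda>x. c)"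
  by (induction k arbitrary: c) auto

lemma Ck_on_bounded_linear:
  assumes "bounded_linear L" "open S" "Ck_on k S f"
  shows "Ck_on k S (\<lambda>x. L (f x))"
  using assms(3)
proof (induction k arbitrary: f)
  case 0
  then show ?case
    using linear_continuous_on[OF assms(1)] by (auto intro: bounded_linear.continuous_on[OF assms(1)])
next
  case (Suc k)
  show ?case
    by (rule Ck_on_SucI[OF assms(2), where f' = "\<lambda>x v. L (fd f x v)"])
      (use Suc bounded_linear.has_derivative[OF assms(1) Ck_on_Suc_has_derivative[OF Suc.prems]]
        in auto)
qed

lemma Ck_on_add:
  assumes "open S" "Ck_on k S f" "Ck_on k S h"
  shows "Ck_on k S (\<lambda>x. f x + h x)"
  using assms(2,3)
proof (induction k arbitrary: f h)
  case 0
  then show ?case by (auto intro: continuous_on_add)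
next
  case (Suc k)
  show ?case
    by (rule Ck_on_SucI[OF assms(1), where f' = "\<lambda>x v. fd f x v + fd h x v"])
      (use Suc Ck_on_Suc_has_derivative[OF Suc.prems(1)] Ck_on_Suc_has_derivative[OF Suc.prems(2)]
        in \<open>auto intro!: has_derivative_add\<close>)
qed

lemma Ck_on_bilinear:
  assumes "bounded_bilinear pr" "open S" "Ck_on k S f" "Ck_on k S h"
  shows "Ck_on k S (\<lambda>x. pr (f x) (h x))"
  using assms(3,4)
proof (induction k arbitrary: f h)
  case 0
  then show ?case using bounded_bilinear.continuous_on[OF assms(1)] by auto
next
  case (Suc k)
  have "Ck_on k S (\<lambda>x. pr (f x) (fd h x v) + pr (fd f x v) (h x))" for v
    using Suc.prems Suc.IH Ck_on_mono_Suc[OF Suc.prems(1)] Ck_on_mono_Suc[OF Suc.prems(2)]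
    by (intro Ck_on_add[OF assms(2)]) auto
  then show ?case
    by (intro Ck_on_SucI[OF assms(2), where f' = "\<lambda>x v. pr (f x) (fd h x v) + pr (fd f x v) (h x)"]
        bounded_bilinear.FDERIV[OF assms(1)] Ck_on_Suc_has_derivative[OF Suc.prems(1)]
        Ck_on_Suc_has_derivative[OF Suc.prems(2)])
qed

lemma Ck_on_sum:
  assumes "open S" "finite I" "\<And>i. i \<in> I \<Longrightarrow> Ck_on k S (f i)"
  shows "Ck_on k S (\<lambda>x. \<Sum>i\<in>I. f i x)"
  using assms(2,3) by (induction rule: finite_induct) (auto intro: Ck_on_const Ck_on_add[OF assms(1)])

lemma fd_eq_sum_Basis:
  fixes f :: "'v::euclidean_space \<Rightarrow> 'w::real_normed_vector"
  assumes "f differentiable (at x)"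
  shows "fd f x v = (\<Sum>b\<in>Basis. (v \<bullet> b) *\<^sub>R fd f x b)"
proof -
  interpret linear "fd f x" using assms by (rule linear_frechet_derivative)
  have "fd f x (\<Sum>b\<in>Basis. (v \<bullet> b) *\<^sub>R b) = (\<Sum>b\<in>Basis. (v \<bullet> b) *\<^sub>R fd f x b)"
    by (simp add: sum scale)
  then show ?thesis by (simp add: euclidean_representation)
qed

text \<open>Class \<open>C\<^sup>k\<close> only controls the derivative in each fixed direction; a variable direction is
reduced to this case by expanding it in the standard basis.\<close>

lemma Ck_on_derivative_along:
  fixes f :: "'v::euclidean_space \<Rightarrow> 'w::real_normed_vector"
  assumes "open S" "\<And>b. Ck_on k S (\<lambda>x. fd f (h x) b)" "Ck_on k S V"
    and df: "\<And>x. x \<in> S \<Longrightarrow> f differentiable (at (h x))"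
  shows "Ck_on k S (\<lambda>x. fd f (h x) (V x))"
proof (rule Ck_on_cong[OF assms(1)])
  show "(\<Sum>b\<in>Basis. (V x \<bullet> b) *\<^sub>R fd f (h x) b) = fd f (h x) (V x)" if "x \<in> S" for x
    using fd_eq_sum_Basis[OF df[OF that]] by (rule sym)
  show "Ck_on k S (\<lambda>x. \<Sum>b\<in>Basis. (V x \<bullet> b) *\<^sub>R fd f (h x) b)"
    by (rule Ck_on_sum[OF assms(1) finite_Basis])
      (rule Ck_on_bilinear[OF bounded_bilinear_scaleR assms(1)
          Ck_on_bounded_linear[OF bounded_linear_inner_left assms(1,3)] assms(2)])
qed

lemma Ck_on_compose:
  fixes f :: "'v::euclidean_space \<Rightarrow> 'w::real_normed_vector"
  assumes "open S" "open T" "h ` S \<subseteq> T" "Ck_on k T f" "Ck_on k S h"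
  shows "Ck_on k S (\<lambda>x. f (h x))"
  using assms(4,5)
proof (induction k arbitrary: f)
  case 0
  then show ?case using continuous_on_compose2[of T f S h] assms(3) by auto
next
  case (Suc k)
  have hT: "h x \<in> T" if "x \<in> S" for x using that assms(3) by auto
  show ?case
  proof (rule Ck_on_SucI[OF assms(1), where f' = "\<lambda>x v. fd f (h x) (fd h x v)"])
    show "((\<lambda>x. f (h x)) has_derivative (\<lambda>v. fd f (h x) (fd h x v))) (at x)" if "x \<in> S" for x
      using diff_chain_at[OF Ck_on_Suc_has_derivative[OF Suc.prems(2) that]
          Ck_on_Suc_has_derivative[OF Suc.prems(1) hT[OF that]]] by (simp add: o_def)
    show "Ck_on k S (\<lambda>x. fd f (h x) (fd h x v))" for v
    proof (rule Ck_on_derivative_along[OF assms(1)])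
      show "Ck_on k S (\<lambda>x. fd f (h x) b)" for b
        using Suc.IH[of "\<lambda>y. fd f y b"] Suc.prems Ck_on_mono_Suc by auto
    qed (use Suc.prems hT in auto)
  qed
qed

text \<open>Stated for all exponents at once because the derivative lowers the exponent by one.  The case
\<open>a = -1/2\<close> serves to normalise vector fields.\<close>

lemma Ck_on_powr:
  fixes f :: "'v::real_normed_vector \<Rightarrow> real"
  assumes "open S" "\<And>x. x \<in> S \<Longrightarrow> f x > 0" "Ck_on k S f"
  shows "Ck_on k S (\<lambda>x. f x powr a)"
  using assms(3)
proof (induction k arbitrary: a)
  case 0
  then have "continuous_on S f" by simp
  then show ?case
    using continuous_on_powr[OF _ continuous_on_const[of S a]] assms(2) by force
next
  case (Suc k)
  have "Ck_on k S (\<lambda>x. a * (f x powr (a - 1) * fd f x v))" for v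
    using Suc Ck_on_mono_Suc[OF Suc.prems]
    by (intro Ck_on_bilinear[OF bounded_bilinear_mult] Ck_on_const assms(1)) auto
  moreover have "((\<lambda>x. f x powr a) has_derivative (\<lambda>v. a * (f x powr (a - 1) * fd f x v))) (at x)"
    if "x \<in> S" for x
    using has_derivative_powr[OF Ck_on_Suc_has_derivative[OF Suc.prems that]
        has_derivative_const[of a] assms(2)[OF that], simplified] assms(2)[OF that]
    by (simp add: powr_diff algebra_simps)
  ultimately show ?case
    by (intro Ck_on_SucI[OF assms(1), where f' = "\<lambda>x v. a * (f x powr (a - 1) * fd f x v)"])
qed

text \<open>The mean value theorem, applied first in direction \<open>u\<close> and then in direction \<open>v\<close>.  The left
hand side of the equation is symmetric in \<open>u\<close> and \<open>v\<close>, which is what makes the mixed second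
derivatives agree.\<close>

lemma mixed_difference_mvt:
  fixes F :: "'v::real_normed_vector \<Rightarrow> real"
  assumes "t > 0" and C2: "Ck_on 2 S F"
    and S: "\<And>r s. 0 \<le> r \<Longrightarrow> r \<le> t \<Longrightarrow> 0 \<le> s \<Longrightarrow> s \<le> t \<Longrightarrow> x + s *\<^sub>R u + r *\<^sub>R v \<in> S"
  obtains r s where "0 < r" "r < t" "0 < s" "s < t"
    "F (x + t *\<^sub>R u + t *\<^sub>R v) - F (x + t *\<^sub>R u) - F (x + t *\<^sub>R v) + F x
      = t * t * fd (\<lambda>y. fd F y u) (x + s *\<^sub>R u + r *\<^sub>R v) v"
proof -
  have dF: "(F has_derivative fd F y) (at y)" if "y \<in> S" for y
    using C2 that Ck_on_Suc_has_derivative[of 1 S F y] by (simp add: numeral_2_eq_2)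
  have dDF: "((\<lambda>y. fd F y u) has_derivative fd (\<lambda>y. fd F y u) y) (at y)" if "y \<in> S" for y
    using C2 that Ck_on_Suc_has_derivative[of 0 S "\<lambda>y. fd F y u" y] by (simp add: numeral_2_eq_2)
  define \<phi> where "\<phi> = (\<lambda>s. F (x + s *\<^sub>R u + t *\<^sub>R v) - F (x + s *\<^sub>R u))"
  have 1: "(\<phi> has_derivative (\<lambda>c. fd F (x + s *\<^sub>R u + t *\<^sub>R v) (c *\<^sub>R u) - fd F (x + s *\<^sub>R u) (c *\<^sub>R u)))
      (at s within {0..t})" if "0 \<le> s" "s \<le> t" for s
  proof -
    have a: "x + s *\<^sub>R u + t *\<^sub>R v \<in> S" "x + s *\<^sub>R u \<in> S"
      using S[of t s] S[of 0 s] that assms(1) by auto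
    have "((\<lambda>s. x + s *\<^sub>R u + t *\<^sub>R v) has_derivative (\<lambda>c. c *\<^sub>R u)) (at s within {0..t})"
         "((\<lambda>s. x + s *\<^sub>R u) has_derivative (\<lambda>c. c *\<^sub>R u)) (at s within {0..t})"
      by (auto intro!: derivative_eq_intros)
    note this[THEN has_derivative_compose, OF dF]
    from this(1)[OF a(1)] this(2)[OF a(2)] show ?thesis
      unfolding \<phi>_def by (rule has_derivative_diff)
  qed
  obtain s where s: "0 < s" "s < t" and
    e1: "\<phi> t - \<phi> 0 = fd F (x + s *\<^sub>R u + t *\<^sub>R v) (t *\<^sub>R u) - fd F (x + s *\<^sub>R u) (t *\<^sub>R u)"
    using mvt_simple[OF assms(1), of \<phi>, OF 1] by auto
  define \<psi> where "\<psi> = (\<lambda>r. fd F (x + s *\<^sub>R u + r *\<^sub>R v) u)"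
  have 2: "(\<psi> has_derivative (\<lambda>c. fd (\<lambda>y. fd F y u) (x + s *\<^sub>R u + r *\<^sub>R v) (c *\<^sub>R v)))
      (at r within {0..t})" if "0 \<le> r" "r \<le> t" for r
  proof -
    have a: "x + s *\<^sub>R u + r *\<^sub>R v \<in> S" using S[of r s] that s by auto
    have "((\<lambda>r. x + s *\<^sub>R u + r *\<^sub>R v) has_derivative (\<lambda>c. c *\<^sub>R v)) (at r within {0..t})"
      by (auto intro!: derivative_eq_intros)
    from has_derivative_compose[OF this dDF[OF a]] show ?thesis unfolding \<psi>_def .
  qed
  obtain r where r: "0 < r" "r < t" and
    e2: "\<psi> t - \<psi> 0 = fd (\<lambda>y. fd F y u) (x + s *\<^sub>R u + r *\<^sub>R v) (t *\<^sub>R v)"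
    using mvt_simple[OF assms(1), of \<psi>, OF 2] by auto
  have lin: "fd F y (t *\<^sub>R u) = t * fd F y u" if "y \<in> S" for y
    using linear_scale[OF has_derivative_linear[OF dF[OF that]]] by simp
  have lin2: "fd (\<lambda>y. fd F y u) y (t *\<^sub>R v) = t * fd (\<lambda>y. fd F y u) y v" if "y \<in> S" for y
    using linear_scale[OF has_derivative_linear[OF dDF[OF that]]] by simp
  have "\<phi> t - \<phi> 0 = t * (\<psi> t - \<psi> 0)"
    using e1 lin S[of t s] S[of 0 s] s assms(1) by (simp add: \<psi>_def algebra_simps)
  also have "\<dots> = t * t * fd (\<lambda>y. fd F y u) (x + s *\<^sub>R u + r *\<^sub>R v) v"
    using e2 lin2 S[of r s] s r by simp
  finally show ?thesis
    using that[OF r s] by (simp add: \<phi>_def)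
qed

text \<open>Otherwise the two mixed derivatives, being continuous, would stay apart on a ball around \<open>x\<close>;
but on a parallelogram inside that ball both take the value of the same mixed difference quotient.\<close>

lemma second_derivative_symmetric:
  fixes F :: "'v::real_normed_vector \<Rightarrow> real"
  assumes S: "open S" "x \<in> S" and C2: "Ck_on 2 S F"
  shows "fd (\<lambda>y. fd F y u) x v = fd (\<lambda>y. fd F y v) x u"
proof (rule ccontr)
  define A where "A = (\<lambda>y. fd (\<lambda>y. fd F y u) y v)"
  define B where "B = (\<lambda>y. fd (\<lambda>y. fd F y v) y u)"
  assume "\<not> ?thesis"
  then have ne: "A x \<noteq> B x" by (simp add: A_def B_def)
  define \<epsilon> where "\<epsilon> = \<bar>A x - B x\<bar> / 2"
  have "\<epsilon> > 0" using ne by (simp add: \<epsilon>_def)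
  have "continuous_on S A" "continuous_on S B"
    using C2 by (auto simp: A_def B_def numeral_2_eq_2)
  then have "isCont A x" "isCont B x" using S continuous_on_eq_continuous_at by blast+
  then obtain d1 d2 where d1: "d1 > 0" "\<And>y. dist y x < d1 \<Longrightarrow> \<bar>A y - A x\<bar> < \<epsilon>"
    and d2: "d2 > 0" "\<And>y. dist y x < d2 \<Longrightarrow> \<bar>B y - B x\<bar> < \<epsilon>"
    using \<open>\<epsilon> > 0\<close> unfolding continuous_at_eps_delta by (metis dist_real_def)
  obtain d3 where d3: "d3 > 0" "ball x d3 \<subseteq> S" using S openE by blast
  define d where "d = min d1 (min d2 d3)"
  have "d > 0" using d1 d2 d3 by (simp add: d_def)
  define L where "L = norm u + norm v + 1"
  define t where "t = d / (2 * L)"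
  have pos: "L > 0" unfolding L_def by (smt (verit) norm_ge_zero)
  then have t: "t > 0" using \<open>d > 0\<close> by (simp add: t_def)
  have "t * (norm u + norm v) \<le> t * L" using t by (simp add: L_def)
  also have "\<dots> = d / 2" using pos by (simp add: t_def field_simps)
  also have "\<dots> < d" using \<open>d > 0\<close> by simp
  finally have t_small: "t * (norm u + norm v) < d" .
  have near: "dist (x + s *\<^sub>R u + r *\<^sub>R v) x < d" if "0 \<le> r" "r \<le> t" "0 \<le> s" "s \<le> t" for r s
  proof -
    have "dist (x + s *\<^sub>R u + r *\<^sub>R v) x = norm (s *\<^sub>R u + r *\<^sub>R v)" by (simp add: dist_norm)
    also have "\<dots> \<le> s * norm u + r * norm v"
      using that norm_triangle_ineq[of "s *\<^sub>R u" "r *\<^sub>R v"] by simp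
    also have "\<dots> \<le> t * norm u + t * norm v"
      using that by (intro add_mono mult_right_mono) auto
    finally show ?thesis using t_small by (simp add: algebra_simps)
  qed
  have near': "dist (x + s *\<^sub>R v + r *\<^sub>R u) x < d" if "0 \<le> r" "r \<le> t" "0 \<le> s" "s \<le> t" for r s
    using near[of s r] that by (simp add: add.commute add.left_commute)
  have inS: "y \<in> S" if "dist y x < d" for y
    using that d3 by (auto simp: d_def dist_commute)
  obtain r s where 1: "0 < r" "r < t" "0 < s" "s < t"
    "F (x + t *\<^sub>R u + t *\<^sub>R v) - F (x + t *\<^sub>R u) - F (x + t *\<^sub>R v) + F x
      = t * t * A (x + s *\<^sub>R u + r *\<^sub>R v)"
    using mixed_difference_mvt[OF t C2 inS[OF near]] unfolding A_def by blast
  obtain r' s' where 2: "0 < r'" "r' < t" "0 < s'" "s' < t"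
    "F (x + t *\<^sub>R v + t *\<^sub>R u) - F (x + t *\<^sub>R v) - F (x + t *\<^sub>R u) + F x
      = t * t * B (x + s' *\<^sub>R v + r' *\<^sub>R u)"
    using mixed_difference_mvt[OF t C2 inS[OF near']] unfolding B_def by blast
  have "t * t * A (x + s *\<^sub>R u + r *\<^sub>R v) = t * t * B (x + s' *\<^sub>R v + r' *\<^sub>R u)"
    using 1(5) 2(5) by (simp add: algebra_simps)
  then have "A (x + s *\<^sub>R u + r *\<^sub>R v) = B (x + s' *\<^sub>R v + r' *\<^sub>R u)"
    using t by simp
  moreover have "\<bar>A (x + s *\<^sub>R u + r *\<^sub>R v) - A x\<bar> < \<epsilon>"
    using d1(2)[of "x + s *\<^sub>R u + r *\<^sub>R v"] near[of r s] 1 by (simp add: d_def)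
  moreover have "\<bar>B (x + s' *\<^sub>R v + r' *\<^sub>R u) - B x\<bar> < \<epsilon>"
    using d2(2)[of "x + s' *\<^sub>R v + r' *\<^sub>R u"] near'[of r' s'] 2 by (simp add: d_def)
  ultimately have "\<bar>A x - B x\<bar> < 2 * \<epsilon>" by linarith
  then show False by (simp add: \<epsilon>_def)
qed

section \<open>Charts, smooth functions and smooth fields\<close>
text \<open>The product rule for \<open>y \<mapsto> DF(y)(Y(y))\<close>.  The first summand is the second derivative of \<open>F\<close>,
which cancels from commutators.\<close>

lemma has_derivative_along_field:
  fixes F :: "'v::euclidean_space \<Rightarrow> real"
  assumes S: "open S" "x \<in> S" and F: "Ck_on 2 S F" and Y: "Y differentiable (at x)"
  shows "((\<lambda>y. fd F y (Y y)) has_derivative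
           (\<lambda>v. fd (\<lambda>y. fd F y (Y x)) x v + fd F x (fd Y x v))) (at x)"
proof -
  have dF: "F differentiable (at y)" if "y \<in> S" for y
    using F that by (simp add: numeral_2_eq_2)
  have dF2: "((\<lambda>y. fd F y b) has_derivative fd (\<lambda>y. fd F y b) x) (at x)" for b
    using F S(2) Ck_on_Suc_has_derivative[of 0 S "\<lambda>y. fd F y b" x] by (simp add: numeral_2_eq_2)
  have dY: "(Y has_derivative fd Y x) (at x)" using Y frechet_derivative_works by blast
  have expand: "(\<Sum>b\<in>Basis. (w \<bullet> b) * fd F y b) = fd F y w" if "y \<in> S" for y w
    using fd_eq_sum_Basis[OF dF[OF that], of w, symmetric] unfolding real_scaleR_def .
  have "((\<lambda>y. \<Sum>b\<in>Basis. (w \<bullet> b) * fd F y b) has_derivative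
      (\<lambda>v. \<Sum>b\<in>Basis. (w \<bullet> b) * fd (\<lambda>y. fd F y b) x v)) (at x)" for w
    by (intro has_derivative_sum has_derivative_mult_right dF2)
  then have D: "((\<lambda>y. fd F y w) has_derivative
      (\<lambda>v. \<Sum>b\<in>Basis. (w \<bullet> b) * fd (\<lambda>y. fd F y b) x v)) (at x)" for w
    by (rule has_derivative_transform_within_open[OF _ S expand])
  have second: "(\<Sum>b\<in>Basis. (w \<bullet> b) * fd (\<lambda>y. fd F y b) x v) = fd (\<lambda>y. fd F y w) x v" for w v
    by (rule fun_cong[OF frechet_derivative_at[OF D]])
  have "((\<lambda>y. \<Sum>b\<in>Basis. (Y y \<bullet> b) * fd F y b) has_derivative
      (\<lambda>v. \<Sum>b\<in>Basis. (Y x \<bullet> b) * fd (\<lambda>y. fd F y b) x v + (fd Y x v \<bullet> b) * fd F x b)) (at x)"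
    by (intro has_derivative_sum has_derivative_mult has_derivative_inner_left dY dF2)
  then have "((\<lambda>y. fd F y (Y y)) has_derivative
      (\<lambda>v. \<Sum>b\<in>Basis. (Y x \<bullet> b) * fd (\<lambda>y. fd F y b) x v + (fd Y x v \<bullet> b) * fd F x b)) (at x)"
    by (rule has_derivative_transform_within_open[OF _ S expand])
  then show ?thesis unfolding sum.distrib second expand[OF S(2)] .
qed

locale manifold =
  fixes M :: "('a, 'n::finite) mfd"
  assumes smooth_manifold: "smooth_manifold M"
begin

lemma is_chart: "c \<in> atlas M \<Longrightarrow> is_chart (mtop M) c"
  using smooth_manifold by (simp add: smooth_manifold_def)

lemma chart_dom_open: "c \<in> atlas M \<Longrightarrow> openin (mtop M) (chart_dom c)"
  using is_chart by (simp add: is_chart_def)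

lemma chart_dom_points: "c \<in> atlas M \<Longrightarrow> p \<in> chart_dom c \<Longrightarrow> p \<in> points M"
  using chart_dom_open openin_subset by blast

lemma coord_homeomorphic:
  "c \<in> atlas M \<Longrightarrow>
    homeomorphic_map (subtopology (mtop M) (chart_dom c)) (top_of_set (coord c ` chart_dom c)) (coord c)"
  using is_chart by (simp add: is_chart_def)

lemma coord_inj: "c \<in> atlas M \<Longrightarrow> inj_on (coord c) (chart_dom c)"
  using homeomorphic_imp_injective_map[OF coord_homeomorphic, of c]
    topspace_subtopology_subset[OF openin_subset[OF chart_dom_open[of c]]] by simp

lemma param_coord [simp]: "c \<in> atlas M \<Longrightarrow> p \<in> chart_dom c \<Longrightarrow> param c (coord c p) = p"
  unfolding param_def by (rule inv_into_f_f[OF coord_inj])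

lemma coord_param:
  "c \<in> atlas M \<Longrightarrow> x \<in> coord c ` (chart_dom c \<inter> U) \<Longrightarrow>
    coord c (param c x) = x \<and> param c x \<in> chart_dom c \<and> param c x \<in> U"
  by auto

lemma open_coord_image:
  assumes "c \<in> atlas M" "openin (mtop M) U"
  shows "open (coord c ` (chart_dom c \<inter> U))"
proof -
  have "openin (subtopology (mtop M) (chart_dom c)) (chart_dom c \<inter> U)"
    using assms(2) by (auto simp: openin_subtopology)
  then have "openin (top_of_set (coord c ` chart_dom c)) (coord c ` (chart_dom c \<inter> U))"
    using homeomorphic_map_openness_eq[OF coord_homeomorphic[OF assms(1)]] by blast
  moreover have "open (coord c ` chart_dom c)"
    using is_chart[OF assms(1)] by (simp add: is_chart_def)
  ultimately show ?thesis using openin_open_trans by blast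
qed

lemma
  assumes "p \<in> points M"
  shows chart_at_atlas: "chart_at M p \<in> atlas M"
    and chart_at_dom: "p \<in> chart_dom (chart_at M p)"
proof -
  have "(\<Union>c\<in>atlas M. chart_dom c) = points M"
    using smooth_manifold by (simp add: smooth_manifold_def)
  then have "\<exists>c. c \<in> atlas M \<and> p \<in> chart_dom c" using assms by blast
  from someI_ex[OF this] show "chart_at M p \<in> atlas M" "p \<in> chart_dom (chart_at M p)"
    by (simp_all add: chart_at_def)
qed

lemma transition_Ck:
  assumes "c \<in> atlas M" "d \<in> atlas M"
  shows "Ck_on k (coord c ` (chart_dom c \<inter> chart_dom d)) (coord d \<circ> param c)"
  using assms smooth_manifold by (simp add: smooth_manifold_def smooth_on_def)

lemma transition_has_derivative:
  assumes "c \<in> atlas M" "d \<in> atlas M" "p \<in> chart_dom c" "p \<in> chart_dom d"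
  shows "((coord d \<circ> param c) has_derivative fd (coord d \<circ> param c) (coord c p)) (at (coord c p))"
  by (rule Ck_on_Suc_has_derivative[OF transition_Ck[OF assms(1,2)]]) (use assms in auto)

text \<open>The chain rule in the form in which all changes of chart are made.  The target is an arbitrary
normed space so that it applies to real functions as well as to other coordinate maps.\<close>

lemma has_derivative_chart_change:
  assumes a: "a \<in> atlas M" "p \<in> chart_dom a" and c: "c \<in> atlas M" "p \<in> chart_dom c"
    and F: "(F \<circ> param c) differentiable (at (coord c p))"
  shows "((F \<circ> param a) has_derivative
    (\<lambda>v. fd (F \<circ> param c) (coord c p) (fd (coord c \<circ> param a) (coord a p) v))) (at (coord a p))"
proof -
  have "((F \<circ> param c) has_derivative fd (F \<circ> param c) (coord c p))
      (at ((coord c \<circ> param a) (coord a p)))"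
    using F a by (simp add: frechet_derivative_works)
  from diff_chain_at[OF transition_has_derivative[OF a(1) c(1) a(2) c(2)] this]
  have "(((F \<circ> param c) \<circ> (coord c \<circ> param a)) has_derivative
    (\<lambda>v. fd (F \<circ> param c) (coord c p) (fd (coord c \<circ> param a) (coord a p) v))) (at (coord a p))"
    by (simp add: o_def)
  then show ?thesis
    by (rule has_derivative_transform_within_open[OF _ open_coord_image[OF a(1) chart_dom_open[OF c(1)]]])
      (use a c in auto)
qed

lemma fd_chart_change:
  assumes "a \<in> atlas M" "p \<in> chart_dom a" "c \<in> atlas M" "p \<in> chart_dom c"
    and "(F \<circ> param c) differentiable (at (coord c p))"
  shows "fd (F \<circ> param a) (coord a p) v
    = fd (F \<circ> param c) (coord c p) (fd (coord c \<circ> param a) (coord a p) v)"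
  using frechet_derivative_at[OF has_derivative_chart_change[OF assms]] by metis

lemma transition_self:
  assumes "c \<in> atlas M" "p \<in> chart_dom c"
  shows "fd (coord c \<circ> param c) (coord c p) v = v"
proof -
  have "fd (coord c \<circ> param c) (coord c p) = fd (\<lambda>x. x) (coord c p)"
    by (rule fd_cong[OF open_coord_image[OF assms(1) chart_dom_open[OF assms(1)]]])
      (use assms in auto)
  then show ?thesis by simp
qed

lemma transition_cocycle:
  assumes "a \<in> atlas M" "p \<in> chart_dom a" "c \<in> atlas M" "p \<in> chart_dom c"
    and "d \<in> atlas M" "p \<in> chart_dom d"
  shows "fd (coord d \<circ> param c) (coord c p) (fd (coord c \<circ> param a) (coord a p) v)
    = fd (coord d \<circ> param a) (coord a p) v"
  using fd_chart_change[OF assms(1-4), of "coord d" v]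
    transition_has_derivative[OF assms(3,5,4,6)] differentiableI by metis

lemma linear_transition:
  assumes "c \<in> atlas M" "d \<in> atlas M" "p \<in> chart_dom c" "p \<in> chart_dom d"
  shows "linear (fd (coord d \<circ> param c) (coord c p))"
  using transition_has_derivative[OF assms] has_derivative_linear by blast

lemma linear_components:
  assumes "c \<in> atlas M" "p \<in> chart_dom c"
  shows "linear (components M c p)"
  using linear_transition[OF chart_at_atlas assms(1) chart_at_dom assms(2)]
    chart_dom_points[OF assms] by (simp add: components_def[abs_def])

lemma components_chart_at [simp]: "p \<in> points M \<Longrightarrow> components M (chart_at M p) p v = v"
  by (simp add: components_def transition_self chart_at_atlas chart_at_dom)

lemma smooth_fun_Ck:
  "smooth_fun M U f \<longleftrightarrow> (\<forall>c\<in>atlas M. \<forall>k. Ck_on k (coord c ` (chart_dom c \<inter> U)) (f \<circ> param c))"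
  by (auto simp: smooth_fun_def smooth_on_def)

lemma smooth_field_Ck:
  "smooth_field M U X \<longleftrightarrow>
    (\<forall>c\<in>atlas M. \<forall>k. Ck_on k (coord c ` (chart_dom c \<inter> U)) (component_field M X c))"
  by (auto simp: smooth_field_def smooth_on_def)

lemma smooth_funD:
  "smooth_fun M U f \<Longrightarrow> c \<in> atlas M \<Longrightarrow> Ck_on k (coord c ` (chart_dom c \<inter> U)) (f \<circ> param c)"
  by (simp add: smooth_fun_Ck)

lemma smooth_fieldD:
  "smooth_field M U X \<Longrightarrow> c \<in> atlas M \<Longrightarrow>
    Ck_on k (coord c ` (chart_dom c \<inter> U)) (component_field M X c)"
  by (simp add: smooth_field_Ck)

lemma component_field_eq:
  assumes "c \<in> atlas M" "x \<in> coord c ` (chart_dom c \<inter> U)"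
  shows "component_field M (\<lambda>p. f p *\<^sub>R X p + h p *\<^sub>R Y p) c x
    = (f \<circ> param c) x *\<^sub>R component_field M X c x + (h \<circ> param c) x *\<^sub>R component_field M Y c x"
proof -
  have "linear (components M c (param c x))"
    using linear_components[of c "param c x"] coord_param[OF assms] assms(1) by simp
  then show ?thesis by (simp add: component_field_def linear_add linear_scale)
qed

context
  fixes U assumes U: "openin (mtop M) U"
begin

lemma smooth_fun_cong:
  assumes "smooth_fun M U f" "\<And>p. p \<in> U \<Longrightarrow> f p = h p"
  shows "smooth_fun M U h"
  unfolding smooth_fun_Ck
proof (intro ballI allI)
  fix c k assume c: "c \<in> atlas M"
  have "Ck_on k (coord c ` (chart_dom c \<inter> U)) (f \<circ> param c)"
    using assms(1) c by (simp add: smooth_fun_Ck)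
  then show "Ck_on k (coord c ` (chart_dom c \<inter> U)) (h \<circ> param c)"
    by (rule Ck_on_cong[OF open_coord_image[OF c U], rotated]) (use assms(2) c in auto)
qed

lemma smooth_field_cong:
  assumes "smooth_field M U X" "\<And>p. p \<in> U \<Longrightarrow> X p = Y p"
  shows "smooth_field M U Y"
  unfolding smooth_field_Ck
proof (intro ballI allI)
  fix c k assume c: "c \<in> atlas M"
  have "Ck_on k (coord c ` (chart_dom c \<inter> U)) (component_field M X c)"
    using assms(1) c by (simp add: smooth_field_Ck)
  then show "Ck_on k (coord c ` (chart_dom c \<inter> U)) (component_field M Y c)"
    by (rule Ck_on_cong[OF open_coord_image[OF c U], rotated])
      (use assms(2) c in \<open>auto simp: component_field_def\<close>)
qed

lemma smooth_fun_const: "smooth_fun M U (\<lambda>p. k)"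
  by (simp add: smooth_fun_Ck o_def Ck_on_const)

lemma smooth_fun_mult: "smooth_fun M U f \<Longrightarrow> smooth_fun M U h \<Longrightarrow> smooth_fun M U (\<lambda>p. f p * h p)"
  unfolding smooth_fun_Ck o_def
  by (intro ballI allI Ck_on_bilinear[OF bounded_bilinear_mult] open_coord_image[OF _ U]) auto

lemma smooth_fun_powr:
  assumes "smooth_fun M U f" "\<And>p. p \<in> U \<Longrightarrow> f p > 0"
  shows "smooth_fun M U (\<lambda>p. f p powr a)"
  unfolding smooth_fun_Ck
proof (intro ballI allI)
  fix c k assume c: "c \<in> atlas M"
  have "Ck_on k (coord c ` (chart_dom c \<inter> U)) (\<lambda>x. (f \<circ> param c) x powr a)"
  proof (rule Ck_on_powr[OF open_coord_image[OF c U]])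
    show "(f \<circ> param c) x > 0" if "x \<in> coord c ` (chart_dom c \<inter> U)" for x
      using coord_param[OF c that] assms(2) by simp
  qed (rule smooth_funD[OF assms(1) c])
  then show "Ck_on k (coord c ` (chart_dom c \<inter> U)) ((\<lambda>p. f p powr a) \<circ> param c)"
    by (simp add: o_def)
qed

lemma smooth_field_lincomb:
  assumes "smooth_fun M U f" "smooth_field M U X" "smooth_fun M U h" "smooth_field M U Y"
  shows "smooth_field M U (\<lambda>p. f p *\<^sub>R X p + h p *\<^sub>R Y p)"
  unfolding smooth_field_Ck
proof (intro ballI allI)
  fix c k assume c: "c \<in> atlas M"
  let ?S = "coord c ` (chart_dom c \<inter> U)"
  have S: "open ?S" by (rule open_coord_image[OF c U])
  have "Ck_on k ?S (\<lambda>x. (f \<circ> param c) x *\<^sub>R component_field M X c x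
      + (h \<circ> param c) x *\<^sub>R component_field M Y c x)"
    by (intro Ck_on_add S Ck_on_bilinear[OF bounded_bilinear_scaleR] smooth_funD smooth_fieldD assms c)
  then show "Ck_on k ?S (component_field M (\<lambda>p. f p *\<^sub>R X p + h p *\<^sub>R Y p) c)"
    by (rule Ck_on_cong[OF S, rotated]) (simp only: component_field_eq[OF c])
qed

lemma smooth_field_scale:
  assumes "smooth_fun M U f" "smooth_field M U X"
  shows "smooth_field M U (\<lambda>p. f p *\<^sub>R X p)"
  using smooth_field_lincomb[OF assms smooth_fun_const[of 0] assms(2)] by simp

lemma smooth_field_add:
  assumes "smooth_field M U X" "smooth_field M U Y"
  shows "smooth_field M U (\<lambda>p. X p + Y p)"
  using smooth_field_lincomb[OF smooth_fun_const[of 1] assms(1) smooth_fun_const[of 1] assms(2)]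
  by simp

lemma smooth_field_diff:
  assumes "smooth_field M U X" "smooth_field M U Y"
  shows "smooth_field M U (\<lambda>p. X p - Y p)"
  using smooth_field_lincomb[OF smooth_fun_const[of 1] assms(1) smooth_fun_const[of "-1"] assms(2)]
  by simp

lemma smooth_field_zero: "smooth_field M U (\<lambda>p. 0)"
proof -
  have "component_field M (\<lambda>p. 0) c x = 0" if "c \<in> atlas M" "x \<in> coord c ` (chart_dom c \<inter> U)" for c x
    using linear_0[OF linear_components[of c "param c x"]] coord_param[OF that] that(1)
    by (simp add: component_field_def)
  then have "Ck_on k (coord c ` (chart_dom c \<inter> U)) (component_field M (\<lambda>p. 0) c)"
    if "c \<in> atlas M" for c k
    using Ck_on_cong[OF open_coord_image[OF that U] _ Ck_on_const[of _ _ 0]] that by metis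
  then show ?thesis by (simp add: smooth_field_Ck)
qed

lemma smooth_field_sum:
  assumes "finite I" "\<And>i. i \<in> I \<Longrightarrow> smooth_field M U (X i)"
  shows "smooth_field M U (\<lambda>p. \<Sum>i\<in>I. X i p)"
  using assms by (induction rule: finite_induct) (auto intro: smooth_field_zero smooth_field_add)

lemma smooth_fun_differentiable:
  assumes "smooth_fun M U f" "p \<in> U" "c \<in> atlas M" "p \<in> chart_dom c"
  shows "(f \<circ> param c) differentiable (at (coord c p))"
proof -
  have "coord c p \<in> coord c ` (chart_dom c \<inter> U)" using assms by simp
  from Ck_on_Suc_has_derivative[OF smooth_funD[OF assms(1,3)] this] show ?thesis
    by (rule differentiableI)
qed

lemma open_subset_points: "p \<in> U \<Longrightarrow> p \<in> points M"
  using U openin_subset by blast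

lemma vec_deriv_chart:
  assumes "smooth_fun M U f" "p \<in> U" "c \<in> atlas M" "p \<in> chart_dom c"
  shows "vec_deriv M p v f = fd (f \<circ> param c) (coord c p) (components M c p v)"
  unfolding vec_deriv_def components_def
  by (rule fd_chart_change)
    (use assms open_subset_points in \<open>auto intro: chart_at_atlas chart_at_dom smooth_fun_differentiable\<close>)

lemma has_derivative_chart_at:
  assumes "smooth_fun M U f" "p \<in> U"
  shows "((f \<circ> param (chart_at M p)) has_derivative (\<lambda>v. vec_deriv M p v f))
    (at (coord (chart_at M p) p))"
  unfolding vec_deriv_def
  using smooth_fun_differentiable[OF assms chart_at_atlas chart_at_dom] open_subset_points[OF assms(2)]
    frechet_derivative_works by blast

lemma vec_deriv_unique:
  assumes "p \<in> U" "((f \<circ> param (chart_at M p)) has_derivative F) (at (coord (chart_at M p) p))"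
  shows "vec_deriv M p v f = F v"
  unfolding vec_deriv_def using frechet_derivative_at[OF assms(2)] by metis

lemma linear_vec_deriv:
  "smooth_fun M U f \<Longrightarrow> p \<in> U \<Longrightarrow> linear (\<lambda>v. vec_deriv M p v f)"
  using has_derivative_chart_at has_derivative_linear by blast

lemma vec_deriv_cong:
  assumes "p \<in> U" "\<And>q. q \<in> U \<Longrightarrow> f q = h q"
  shows "vec_deriv M p v f = vec_deriv M p v h"
proof -
  note a = chart_at_atlas[OF open_subset_points[OF assms(1)]] chart_at_dom[OF open_subset_points[OF assms(1)]]
  have "fd (f \<circ> param (chart_at M p)) (coord (chart_at M p) p)
      = fd (h \<circ> param (chart_at M p)) (coord (chart_at M p) p)"
    by (rule fd_cong[OF open_coord_image[OF a(1) U]]) (use a assms in auto)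
  then show ?thesis by (simp add: vec_deriv_def)
qed

lemma vec_deriv_const [simp]: "vec_deriv M p v (\<lambda>q. k) = 0"
  by (simp add: vec_deriv_def o_def)

lemma vec_deriv_add:
  assumes "smooth_fun M U f" "smooth_fun M U h" "p \<in> U"
  shows "vec_deriv M p v (\<lambda>q. f q + h q) = vec_deriv M p v f + vec_deriv M p v h"
  using vec_deriv_unique[OF assms(3), of "\<lambda>q. f q + h q"]
    has_derivative_add[OF has_derivative_chart_at[OF assms(1,3)] has_derivative_chart_at[OF assms(2,3)]]
  by (simp add: o_def)

lemma vec_deriv_mult:
  assumes "smooth_fun M U f" "smooth_fun M U h" "p \<in> U"
  shows "vec_deriv M p v (\<lambda>q. f q * h q) = f p * vec_deriv M p v h + vec_deriv M p v f * h p"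
  using vec_deriv_unique[OF assms(3), of "\<lambda>q. f q * h q"]
    has_derivative_mult[OF has_derivative_chart_at[OF assms(1,3)] has_derivative_chart_at[OF assms(2,3)]]
    open_subset_points[OF assms(3)]
  by (simp add: o_def chart_at_atlas chart_at_dom)

lemma field_deriv_chart:
  assumes "smooth_fun M U f" "c \<in> atlas M" "x \<in> coord c ` (chart_dom c \<inter> U)"
  shows "(field_deriv M X f \<circ> param c) x = fd (f \<circ> param c) x (component_field M X c x)"
  using coord_param[OF assms(2,3)] vec_deriv_chart[OF assms(1) _ assms(2), of "param c x"]
  by (simp add: field_deriv_def component_field_def)

lemma smooth_fun_field_deriv:
  assumes f: "smooth_fun M U f" and X: "smooth_field M U X"
  shows "smooth_fun M U (field_deriv M X f)"
  unfolding smooth_fun_Ck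
proof (intro ballI allI)
  fix c k assume c: "c \<in> atlas M"
  let ?S = "coord c ` (chart_dom c \<inter> U)"
  have S: "open ?S" by (rule open_coord_image[OF c U])
  have F: "Ck_on (Suc k) ?S (f \<circ> param c)" using f c by (auto simp: smooth_fun_Ck simp del: Ck_on.simps)
  have "Ck_on k ?S (\<lambda>x. fd (f \<circ> param c) x (component_field M X c x))"
    by (rule Ck_on_derivative_along[OF S]) (use F X c in \<open>auto simp: smooth_field_Ck\<close>)
  then show "Ck_on k ?S (field_deriv M X f \<circ> param c)"
    by (rule Ck_on_cong[OF S, rotated]) (rule field_deriv_chart[OF f c, symmetric])
qed

text \<open>In coordinates both iterated derivatives contain the second derivative of \<open>f\<close> in the directions
\<open>X p\<close> and \<open>Y p\<close>, which drops out by symmetry; what is left is the coordinate expression of the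
bracket.\<close>

lemma vec_deriv_lie_bracket:
  assumes f: "smooth_fun M U f" and X: "smooth_field M U X" and Y: "smooth_field M U Y"
    and p: "p \<in> U"
  shows "vec_deriv M p (lie_bracket M X Y p) f
    = field_deriv M X (field_deriv M Y f) p - field_deriv M Y (field_deriv M X f) p"
proof -
  define a where "a = chart_at M p"
  define x where "x = coord a p"
  define F where "F = f \<circ> param a"
  define S where "S = coord a ` (chart_dom a \<inter> U)"
  note pM = open_subset_points[OF p]
  have a: "a \<in> atlas M" "p \<in> chart_dom a" using chart_at_atlas chart_at_dom pM by (auto simp: a_def)
  have S: "open S" "x \<in> S" using open_coord_image[OF a(1) U] a(2) p by (auto simp: S_def x_def)
  have F: "Ck_on k S F" for k using f a by (auto simp: smooth_fun_Ck S_def F_def)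
  have field: "field_deriv M Z (field_deriv M W f) p
        = fd (\<lambda>y. fd F y (W p)) x (Z p) + fd F x (fd (component_field M W a) x (Z p))"
    if W: "smooth_field M U W" for Z W
  proof -
    let ?W = "component_field M W a"
    have Wx: "?W x = W p"
      using a pM unfolding component_field_def x_def by (simp add: a_def)
    have "Ck_on (Suc 0) S ?W" using W a(1) unfolding smooth_field_Ck S_def by blast
    then have "?W differentiable (at x)" using S by auto
    then have "((\<lambda>y. fd F y (?W y)) has_derivative
        (\<lambda>v. fd (\<lambda>y. fd F y (W p)) x v + fd F x (fd ?W x v))) (at x)"
      using has_derivative_along_field[OF S F, of ?W] unfolding Wx by blast
    then have "((field_deriv M W f \<circ> param a) has_derivative
        (\<lambda>v. fd (\<lambda>y. fd F y (W p)) x v + fd F x (fd ?W x v))) (at x)"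
      by (rule has_derivative_transform_within_open[OF _ S])
        (use field_deriv_chart[OF f a(1)] in \<open>simp add: S_def F_def\<close>)
    then show ?thesis
      using vec_deriv_unique[OF p] unfolding field_deriv_def a_def x_def by blast
  qed
  have "linear (fd F x)"
    using Ck_on_Suc_has_derivative[OF F S(2)] has_derivative_linear by blast
  then have "vec_deriv M p (lie_bracket M X Y p) f
    = fd F x (fd (component_field M Y a) x (X p)) - fd F x (fd (component_field M X a) x (Y p))"
    by (simp add: vec_deriv_def lie_bracket_def Let_def a_def x_def F_def linear_diff)
  then show ?thesis
    using field[OF X] field[OF Y] second_derivative_symmetric[OF S F] by simp
qed

end

lemma smooth_field_subset: "smooth_field M U X \<Longrightarrow> V \<subseteq> U \<Longrightarrow> smooth_field M V X"
  unfolding smooth_field_Ck by (blast intro: Ck_on_subset)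

lemma locally_constant:
  assumes U: "openin (mtop M) U" and f: "smooth_fun M U f" and p: "p \<in> U"
    and zero: "\<And>q v. q \<in> U \<Longrightarrow> vec_deriv M q v f = 0"
  obtains V where "openin (mtop M) V" "p \<in> V" "\<And>q. q \<in> V \<Longrightarrow> f q = f p"
proof -
  define a where "a = chart_at M p"
  have pM: "p \<in> points M" by (rule open_subset_points[OF U p])
  have a: "a \<in> atlas M" "p \<in> chart_dom a" using chart_at_atlas chart_at_dom pM by (auto simp: a_def)
  let ?S = "coord a ` (chart_dom a \<inter> U)"
  have S: "open ?S" "coord a p \<in> ?S" using open_coord_image[OF a(1) U] a(2) p by auto
  obtain e where e: "e > 0" "ball (coord a p) e \<subseteq> ?S" using S openE by blast
  have d0: "((f \<circ> param a) has_derivative (\<lambda>v. 0)) (at x)" if x: "x \<in> ?S" for x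
  proof -
    obtain q where q: "q \<in> chart_dom a" "q \<in> U" "x = coord a q" using x by blast
    have qM: "q \<in> points M" by (rule open_subset_points[OF U q(2)])
    note cq = chart_at_atlas[OF qM] chart_at_dom[OF qM]
    have "((f \<circ> param a) has_derivative
        (\<lambda>v. fd (f \<circ> param (chart_at M q)) (coord (chart_at M q) q)
          (fd (coord (chart_at M q) \<circ> param a) (coord a q) v))) (at (coord a q))"
      by (rule has_derivative_chart_change[OF a(1) q(1) cq smooth_fun_differentiable[OF U f q(2) cq]])
    then show ?thesis using zero[OF q(2)] q(3) by (simp add: vec_deriv_def)
  qed
  have const: "(f \<circ> param a) x = (f \<circ> param a) (coord a p)" if "x \<in> ball (coord a p) e" for x
  proof (rule Derivative.has_derivative_zero_unique[OF convex_ball _ that])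
    show "((f \<circ> param a) has_derivative (\<lambda>h. 0)) (at y within ball (coord a p) e)"
      if "y \<in> ball (coord a p) e" for y
      using d0 e(2) that by (blast intro: has_derivative_at_withinI)
  qed (use e(1) in simp)
  define V where "V = {q \<in> topspace (subtopology (mtop M) (chart_dom a)). coord a q \<in> ball (coord a p) e}"
  have "continuous_map (subtopology (mtop M) (chart_dom a)) euclidean (coord a)"
    using homeomorphic_imp_continuous_map[OF coord_homeomorphic[OF a(1)]]
    by (simp add: continuous_map_in_subtopology)
  then have "openin (subtopology (mtop M) (chart_dom a)) V"
    unfolding V_def by (intro openin_continuous_map_preimage) auto
  then have "openin (mtop M) V"
    using chart_dom_open[OF a(1)] openin_trans_full by blast
  moreover have "p \<in> V" using a pM e(1) by (simp add: V_def)
  moreover have "f q = f p" if "q \<in> V" for q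
    using const[of "coord a q"] that a by (simp add: V_def)
  ultimately show ?thesis using that by blast
qed

text \<open>A function with vanishing derivative is locally constant, so its level sets are open and closed.\<close>

lemma constant_of_vec_deriv_zero:
  assumes conn: "connected_space (mtop M)"
    and f: "\<And>p. p \<in> points M \<Longrightarrow> \<exists>U. openin (mtop M) U \<and> p \<in> U \<and> smooth_fun M U f"
    and zero: "\<And>p v. p \<in> points M \<Longrightarrow> vec_deriv M p v f = 0"
    and pq: "p \<in> points M" "q \<in> points M"
  shows "f p = f q"
proof -
  have loc: "\<exists>V. openin (mtop M) V \<and> r \<in> V \<and> (\<forall>s\<in>V. f s = f r)" if r: "r \<in> points M" for r
  proof -
    obtain U where U: "openin (mtop M) U" "r \<in> U" "smooth_fun M U f" using f[OF r] by blast
    show ?thesis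
    proof (rule locally_constant[OF U(1,3,2)])
      show "vec_deriv M q v f = 0" if "q \<in> U" for q v by (rule zero[OF open_subset_points[OF U(1) that]])
    qed blast
  qed
  have op: "openin (mtop M) {r \<in> points M. P (f r)}" for P
  proof (subst openin_subopen, intro ballI)
    fix r assume "r \<in> {r \<in> points M. P (f r)}"
    then have r: "r \<in> points M" "P (f r)" by auto
    obtain V where V: "openin (mtop M) V" "r \<in> V" "\<forall>s\<in>V. f s = f r" using loc[OF r(1)] by blast
    have "s \<in> points M \<and> P (f s)" if "s \<in> V" for s
      using V(3)[rule_format, OF that] r(2) open_subset_points[OF V(1) that] by simp
    then have "V \<subseteq> {r \<in> points M. P (f r)}" by blast
    then show "\<exists>T. openin (mtop M) T \<and> r \<in> T \<and> T \<subseteq> {r \<in> points M. P (f r)}" using V by blast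
  qed
  have "points M - {r \<in> points M. f r = f p} = {r \<in> points M. f r \<noteq> f p}" by blast
  then have "closedin (mtop M) {r \<in> points M. f r = f p}"
    using op[of "\<lambda>y. y \<noteq> f p"] by (simp add: closedin_def)
  then have "{r \<in> points M. f r = f p} = {} \<or> {r \<in> points M. f r = f p} = points M"
    using conn op[of "\<lambda>y. y = f p"] unfolding connected_space_clopen_in by blast
  moreover have "p \<in> {r \<in> points M. f r = f p}" using pq by simp
  ultimately have "q \<in> {r \<in> points M. f r = f p}" using pq by blast
  then show ?thesis by simp
qed

end

section \<open>Orthonormal frames and gradients\<close>
context manifold begin

text \<open>The field whose components in the chart \<open>c\<close> are constantly \<open>v\<close>.  Tangent vectors at \<open>p\<close> are
encoded in the chart chosen at \<open>p\<close>, hence the transition derivative.\<close>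

definition coordinate_field :: "('a, 'n) chart \<Rightarrow> real^'n \<Rightarrow> ('a, 'n) field" where
  "coordinate_field c v p = fd (coord (chart_at M p) \<circ> param c) (coord c p) v"

lemma components_coordinate_field:
  assumes "c \<in> atlas M" "p \<in> chart_dom c" "d \<in> atlas M" "p \<in> chart_dom d"
  shows "components M d p (coordinate_field c v p) = fd (coord d \<circ> param c) (coord c p) v"
  using chart_dom_points[OF assms(1,2)] unfolding components_def coordinate_field_def
  by (intro transition_cocycle assms chart_at_atlas chart_at_dom)

lemma linear_coordinate_field:
  assumes "c \<in> atlas M" "p \<in> chart_dom c"
  shows "linear (\<lambda>v. coordinate_field c v p)"
  using chart_dom_points[OF assms] unfolding coordinate_field_def
  by (intro linear_transition assms chart_at_atlas chart_at_dom)

lemma coordinate_field_eq_0: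
  assumes "c \<in> atlas M" "p \<in> chart_dom c" "coordinate_field c v p = 0"
  shows "v = 0"
  using components_coordinate_field[OF assms(1,2,1,2), of v] assms(3)
    linear_0[OF linear_components[OF assms(1,2)]] transition_self[OF assms(1,2)] by simp

lemma smooth_coordinate_field:
  assumes c: "c \<in> atlas M"
  shows "smooth_field M (chart_dom c) (coordinate_field c v)"
  unfolding smooth_field_Ck
proof (intro ballI allI)
  fix d k assume d: "d \<in> atlas M"
  let ?S = "coord d ` (chart_dom d \<inter> chart_dom c)" and ?T = "coord c ` (chart_dom c \<inter> chart_dom d)"
  have S: "open ?S" by (rule open_coord_image[OF d chart_dom_open[OF c]])
  have T: "open ?T" by (rule open_coord_image[OF c chart_dom_open[OF d]])
  have "Ck_on (Suc k) ?T (coord d \<circ> param c)" by (rule transition_Ck[OF c d])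
  then have D: "Ck_on k ?T (\<lambda>y. fd (coord d \<circ> param c) y v)" by simp
  have im: "(coord c \<circ> param d) ` ?S \<subseteq> ?T" using c d by auto
  have "Ck_on k ?S (\<lambda>x. fd (coord d \<circ> param c) ((coord c \<circ> param d) x) v)"
    by (rule Ck_on_compose[OF S T im D transition_Ck[OF d c]])
  then show "Ck_on k ?S (component_field M (coordinate_field c v) d)"
  proof (rule Ck_on_cong[OF S, rotated])
    fix x assume "x \<in> ?S"
    from coord_param[OF d this]
    show "fd (coord d \<circ> param c) ((coord c \<circ> param d) x) v
        = component_field M (coordinate_field c v) d x"
      by (simp add: component_field_def components_coordinate_field[OF c _ d])
  qed
qed

end

locale riemannian_manifold = manifold M for M :: "('a, 'n::finite) mfd" +
  fixes g :: "('a, 'n) metric_tensor"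
  assumes riemannian_metric: "riemannian_metric M g"
begin

lemma metric_bilinear: "p \<in> points M \<Longrightarrow> bilinear (g p)"
  and metric_sym: "p \<in> points M \<Longrightarrow> g p v w = g p w v"
  and metric_pos: "p \<in> points M \<Longrightarrow> v \<noteq> 0 \<Longrightarrow> g p v v > 0"
  using riemannian_metric by (auto simp: riemannian_metric_def)

lemma smooth_metric:
  "openin (mtop M) U \<Longrightarrow> smooth_field M U X \<Longrightarrow> smooth_field M U Y \<Longrightarrow>
    smooth_fun M U (\<lambda>p. g p (X p) (Y p))"
  using riemannian_metric by (simp add: riemannian_metric_def)

lemma metric_linear:
  assumes "p \<in> points M"
  shows "linear (\<lambda>v. g p v w)" "linear (\<lambda>v. g p w v)"
  using metric_bilinear[OF assms] by (auto simp: bilinear_def)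

lemma metric_simps:
  assumes "p \<in> points M"
  shows "g p (u + v) w = g p u w + g p v w" "g p w (u + v) = g p w u + g p w v"
    "g p (u - v) w = g p u w - g p v w" "g p w (u - v) = g p w u - g p w v"
    "g p (k *\<^sub>R v) w = k * g p v w" "g p w (k *\<^sub>R v) = k * g p w v"
    "g p 0 w = 0" "g p w 0 = 0"
    "g p (\<Sum>i\<in>I. X i) w = (\<Sum>i\<in>I. g p (X i) w)" "g p w (\<Sum>i\<in>I. X i) = (\<Sum>i\<in>I. g p w (X i))"
  using metric_linear[OF assms, of w, THEN linear_add] metric_linear[OF assms, of w, THEN linear_diff]
    metric_linear[OF assms, of w, THEN linear_scale] metric_linear[OF assms, of w, THEN linear_0]
    metric_linear[OF assms, of w, THEN linear_sum]
  by simp_all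

text \<open>The map sending a coordinate vector to the corresponding combination of the \<open>e i\<close> is injective,
its coefficients being recovered by pairing with the \<open>e j\<close>; so it is onto for dimension reasons.\<close>

lemma orthonormal_expansion:
  fixes e :: "'n \<Rightarrow> real^'n"
  assumes p: "p \<in> points M" and e: "\<And>i j. g p (e i) (e j) = (if i = j then 1 else 0)"
  shows "v = (\<Sum>i\<in>UNIV. g p v (e i) *\<^sub>R e i)"
proof -
  define T where "T = (\<lambda>x::real^'n. \<Sum>i\<in>UNIV. x $ i *\<^sub>R e i)"
  have coeff: "g p (T x) (e j) = x $ j" for x j
    by (simp add: T_def metric_simps[OF p] e if_distrib cong: if_cong)
  have lin: "linear T"
    by (rule linearI) (simp_all add: T_def algebra_simps sum.distrib scaleR_sum_right)
  have "inj T"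
  proof (rule injI)
    fix x y assume "T x = T y"
    then have "x $ j = y $ j" for j using coeff[of x j] coeff[of y j] by simp
    then show "x = y" by (simp add: vec_eq_iff)
  qed
  then have "surj T" using linear_injective_imp_surjective[OF lin] by simp
  then obtain x where x: "v = T x" by blast
  show ?thesis unfolding x coeff by (simp add: T_def)
qed

text \<open>The Riesz representation of the derivative in an orthonormal basis.  It shows that the definite
description in the definition of the gradient is well defined, and the explicit sum makes
smoothness of the gradient visible.\<close>

lemma
  fixes e :: "'n \<Rightarrow> real^'n"
  assumes U: "openin (mtop M) U" and f: "smooth_fun M U f" and p: "p \<in> U"
    and e: "\<And>i j. g p (e i) (e j) = (if i = j then 1 else 0)"
  shows gradient_eq: "gradient M g f p = (\<Sum>i\<in>UNIV. vec_deriv M p (e i) f *\<^sub>R e i)" (is "_ = ?v")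
    and metric_gradient_at: "g p (gradient M g f p) w = vec_deriv M p w f"
proof -
  have pM: "p \<in> points M" by (rule open_subset_points[OF U p])
  have D: "linear (\<lambda>v. vec_deriv M p v f)" by (rule linear_vec_deriv[OF U f p])
  have riesz: "g p ?v w = vec_deriv M p w f" for w
  proof -
    have "vec_deriv M p (\<Sum>i\<in>UNIV. g p w (e i) *\<^sub>R e i) f = (\<Sum>i\<in>UNIV. g p w (e i) * vec_deriv M p (e i) f)"
      using linear_sum[OF D, of "\<lambda>i. g p w (e i) *\<^sub>R e i" UNIV] by (simp add: linear_scale[OF D])
    also have "\<dots> = g p ?v w"
      using metric_sym[OF pM] by (simp add: metric_simps[OF pM] mult.commute)
    finally show ?thesis
      unfolding orthonormal_expansion[OF pM e, of w, symmetric] by (rule sym)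
  qed
  show eq: "gradient M g f p = ?v" unfolding gradient_def
  proof (rule the_equality)
    fix v assume v: "\<forall>w. g p v w = vec_deriv M p w f"
    have "g p (v - ?v) (v - ?v) = 0" using v riesz by (simp add: metric_simps(3)[OF pM])
    then show "v = ?v" using metric_pos[OF pM, of "v - ?v"] by force
  qed (simp add: riesz)
  show "g p (gradient M g f p) w = vec_deriv M p w f" unfolding eq by (rule riesz)
qed

text \<open>Gram-Schmidt on a chart domain.  The induction runs over finite sets of indices since the index
type carries no order.  The last clause keeps each \<open>e i\<close> in the span of the coordinate fields
already used, so that the next coordinate field is never a combination of them and the vector to
be normalised does not vanish.\<close>

lemma gram_schmidt_coordinate_fields:
  assumes c: "c \<in> atlas M" and "finite I"
  shows "\<exists>e. (\<forall>i\<in>I. smooth_field M (chart_dom c) (e i)) \<and>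
    (\<forall>p\<in>chart_dom c. \<forall>i\<in>I.
      (\<forall>j\<in>I. g p (e i p) (e j p) = (if i = j then 1 else 0)) \<and>
      (\<exists>v. e i p = coordinate_field c v p \<and> (\<forall>j. j \<notin> I \<longrightarrow> v $ j = 0)))"
  using assms(2)
proof (induction rule: finite_induct)
  case (insert k I)
  let ?U = "chart_dom c"
  have U: "openin (mtop M) ?U" by (rule chart_dom_open[OF c])
  obtain e where smooth: "\<forall>i\<in>I. smooth_field M ?U (e i)"
    and orth: "\<And>p i j. p \<in> ?U \<Longrightarrow> i \<in> I \<Longrightarrow> j \<in> I \<Longrightarrow> g p (e i p) (e j p) = (if i = j then 1 else 0)"
    and span: "\<And>p i. p \<in> ?U \<Longrightarrow> i \<in> I \<Longrightarrow> \<exists>v. e i p = coordinate_field c v p \<and> (\<forall>j. j \<notin> I \<longrightarrow> v $ j = 0)"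
    using insert.IH by blast
  let ?X = "coordinate_field c (axis k 1)"
  define w where "w p = ?X p - (\<Sum>i\<in>I. g p (?X p) (e i p) *\<^sub>R e i p)" for p
  (* For a positive number r, r powr (-1/2) is 1 / sqrt r; the power form is smooth by Ck_on_powr. *)
  define E where "E p = (g p (w p) (w p)) powr (-1/2) *\<^sub>R w p" for p
  note sX = smooth_coordinate_field[OF c, of "axis k 1"]
  have sw: "smooth_field M ?U w"
    unfolding w_def using smooth insert.hyps
    by (intro smooth_field_diff[OF U] smooth_field_sum[OF U] smooth_field_scale[OF U]
        smooth_metric[OF U] sX) auto
  have w_span: "\<exists>v. w p = coordinate_field c v p \<and> v $ k = 1 \<and> (\<forall>j. j \<notin> insert k I \<longrightarrow> v $ j = 0)"
    if p: "p \<in> ?U" for p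
  proof -
    obtain u where u: "\<And>i. i \<in> I \<Longrightarrow> e i p = coordinate_field c (u i) p"
      "\<And>i j. i \<in> I \<Longrightarrow> j \<notin> I \<Longrightarrow> u i $ j = 0"
      using span[OF p] by metis
    note lin = linear_coordinate_field[OF c p]
    define v where "v = axis k 1 - (\<Sum>i\<in>I. g p (?X p) (e i p) *\<^sub>R u i)"
    have "coordinate_field c v p = w p"
      by (simp add: v_def w_def linear_diff[OF lin] linear_sum[OF lin] linear_scale[OF lin] u(1))
    moreover have "v $ j = axis k 1 $ j" if "j \<notin> I" for j
      using u(2)[OF _ that] by (simp add: v_def)
    then have "v $ k = 1" "\<forall>j. j \<notin> insert k I \<longrightarrow> v $ j = 0"
      using insert.hyps by (auto simp: axis_def)
    ultimately show ?thesis by metis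
  qed
  have w_pos: "g p (w p) (w p) > 0" if p: "p \<in> ?U" for p
  proof -
    obtain v where v: "w p = coordinate_field c v p" "v $ k = 1" using w_span[OF p] by blast
    then have "w p \<noteq> 0" using coordinate_field_eq_0[OF c p, of v] by auto
    then show ?thesis using metric_pos chart_dom_points[OF c p] by blast
  qed
  have w_orth: "g p (w p) (e j p) = 0" if p: "p \<in> ?U" and j: "j \<in> I" for p j
    using insert.hyps j chart_dom_points[OF c p]
    by (simp add: w_def metric_simps orth[OF p _ j] if_distrib cong: if_cong)
  have E_unit: "g p (E p) (E p) = 1" if p: "p \<in> ?U" for p
  proof -
    have "g p (E p) (E p) = g p (w p) (w p) powr (-1/2) * g p (w p) (w p) powr (-1/2) * g p (w p) (w p)"
      using chart_dom_points[OF c p] by (simp add: E_def metric_simps)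
    also have "\<dots> = g p (w p) (w p) powr (-1) * g p (w p) (w p) powr 1"
      using w_pos[OF p] by (simp add: powr_add[symmetric])
    also have "\<dots> = 1" using w_pos[OF p] by (simp add: powr_add[symmetric] del: powr_one)
    finally show ?thesis .
  qed
  have E_orth: "g p (E p) (e j p) = 0" "g p (e j p) (E p) = 0" if p: "p \<in> ?U" and j: "j \<in> I" for p j
    using w_orth[OF p j] chart_dom_points[OF c p] metric_sym[of p "e j p" "w p"]
    by (simp_all add: E_def metric_simps)
  have sE: "smooth_field M ?U E"
    unfolding E_def
    by (intro smooth_field_scale[OF U] smooth_fun_powr[OF U] smooth_metric[OF U] sw w_pos)
  have E_span: "\<exists>v. E p = coordinate_field c v p \<and> (\<forall>j. j \<notin> insert k I \<longrightarrow> v $ j = 0)"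
    if p: "p \<in> ?U" for p
  proof -
    obtain v where v: "w p = coordinate_field c v p" "\<forall>j. j \<notin> insert k I \<longrightarrow> v $ j = 0"
      using w_span[OF p] by blast
    let ?r = "g p (w p) (w p) powr (-1/2)"
    have "E p = coordinate_field c (?r *\<^sub>R v) p"
      by (simp add: E_def v(1) linear_scale[OF linear_coordinate_field[OF c p]])
    moreover have "\<forall>j. j \<notin> insert k I \<longrightarrow> (?r *\<^sub>R v) $ j = 0" using v(2) by simp
    ultimately show ?thesis by blast
  qed
  have old_span: "\<exists>v. e i p = coordinate_field c v p \<and> (\<forall>j. j \<notin> insert k I \<longrightarrow> v $ j = 0)"
    if "p \<in> ?U" "i \<in> I" for p i
    using span[OF that] by blast
  show ?case
  proof (intro exI[of _ "e(k := E)"] conjI ballI)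
    show "smooth_field M ?U ((e(k := E)) i)" if "i \<in> insert k I" for i
      using that smooth sE by auto
  next
    fix p i j assume p: "p \<in> ?U" and i: "i \<in> insert k I" and j: "j \<in> insert k I"
    show "g p ((e(k := E)) i p) ((e(k := E)) j p) = (if i = j then 1 else 0)"
      using i j insert.hyps E_unit[OF p] E_orth[OF p] orth[OF p] by auto
  next
    fix p i assume p: "p \<in> ?U" and i: "i \<in> insert k I"
    show "\<exists>v. (e(k := E)) i p = coordinate_field c v p \<and> (\<forall>j. j \<notin> insert k I \<longrightarrow> v $ j = 0)"
      using i E_span[OF p] old_span[OF p] by (cases "i = k") auto
  qed
qed simp

lemma orthonormal_frame_at:
  assumes p: "p \<in> points M"
  obtains U where "p \<in> U" "orthonormal_frame M g U (frame_at M g p)"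
proof -
  let ?c = "chart_at M p"
  note c = chart_at_atlas[OF p] chart_at_dom[OF p]
  from gram_schmidt_coordinate_fields[OF c(1) finite[of UNIV]]
  obtain e :: "'n \<Rightarrow> ('a, 'n) field" where "\<forall>i. smooth_field M (chart_dom ?c) (e i)"
    "\<forall>q\<in>chart_dom ?c. \<forall>i j. g q (e i q) (e j q) = (if i = j then 1 else 0)"
    by blast
  then have "orthonormal_frame M g (chart_dom ?c) e"
    using chart_dom_open[OF c(1)] by (simp add: orthonormal_frame_def)
  then have "\<exists>e U. p \<in> U \<and> orthonormal_frame M g U e" using c(2) by blast
  then have "\<exists>U. p \<in> U \<and> orthonormal_frame M g U (frame_at M g p)"
    unfolding frame_at_def by (rule someI_ex)
  then show ?thesis using that by blast
qed

lemma
  assumes f: "smooth_fun M U f" and e: "orthonormal_frame M g U e"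
  shows smooth_gradient: "smooth_field M U (gradient M g f)"
    and metric_gradient: "p \<in> U \<Longrightarrow> g p (gradient M g f p) w = vec_deriv M p w f"
proof -
  have U: "openin (mtop M) U" and se: "\<And>i. smooth_field M U (e i)"
    and orth: "\<And>q i j. q \<in> U \<Longrightarrow> g q (e i q) (e j q) = (if i = j then 1 else 0)"
    using e by (auto simp: orthonormal_frame_def)
  note eq = gradient_eq[OF U f _ orth]
  have "smooth_field M U (\<lambda>q. \<Sum>i\<in>UNIV. field_deriv M (e i) f q *\<^sub>R e i q)"
    by (intro smooth_field_sum[OF U] smooth_field_scale[OF U] smooth_fun_field_deriv[OF U] f se finite)
  then show "smooth_field M U (gradient M g f)"
    by (rule smooth_field_cong[OF U]) (simp add: eq field_deriv_def)
  show "g p (gradient M g f p) w = vec_deriv M p w f" if "p \<in> U"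
    by (rule metric_gradient_at[OF U f that orth[OF that]])
qed

end

section \<open>The Levi-Civita connection\<close>
context manifold begin

lemma vec_deriv_diff_const: "vec_deriv M p v (\<lambda>q. f q - k) = vec_deriv M p v f"
proof -
  have "((\<lambda>x. F x - k) has_derivative F') (at x) \<longleftrightarrow> (F has_derivative F') (at x)"
    for F :: "real^'n \<Rightarrow> real" and F' x
    using has_derivative_add_const[of "\<lambda>x. F x - k" F' "at x" k]
      has_derivative_add_const[of F F' "at x" "-k"] by auto
  then show ?thesis by (simp add: vec_deriv_def frechet_derivative_def o_def)
qed

end

locale levi_civita_manifold = riemannian_manifold M g
  for M :: "('a, 'n::finite) mfd" and g :: "('a, 'n) metric_tensor" +
  fixes nabla :: "('a, 'n) connection"
  assumes levi_civita: "levi_civita M g nabla"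
begin

context
  fixes U assumes U: "openin (mtop M) U"
begin

lemma nabla_axioms:
  assumes "smooth_field M U X" "smooth_field M U Y" "smooth_field M U Z" "smooth_fun M U f"
  shows "smooth_field M U (nabla X Y)"
    and "p \<in> U \<Longrightarrow> nabla (\<lambda>q. X q + Y q) Z p = nabla X Z p + nabla Y Z p"
    and "p \<in> U \<Longrightarrow> nabla (\<lambda>q. f q *\<^sub>R X q) Y p = f p *\<^sub>R nabla X Y p"
  using levi_civita U assms unfolding levi_civita_def affine_connection_def by blast+

lemma smooth_nabla:
  "smooth_field M U X \<Longrightarrow> smooth_field M U Y \<Longrightarrow> smooth_field M U (nabla X Y)"
  using nabla_axioms(1) smooth_fun_const[OF U] by blast

lemma torsion_free:
  assumes "smooth_field M U X" "smooth_field M U Y" "p \<in> U"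
  shows "lie_bracket M X Y p = nabla X Y p - nabla Y X p"
  using levi_civita U assms unfolding levi_civita_def by metis

lemma metric_compatible:
  assumes "smooth_field M U X" "smooth_field M U Y" "smooth_field M U Z" "p \<in> U"
  shows "vec_deriv M p (X p) (\<lambda>q. g q (Y q) (Z q))
    = g p (nabla X Y p) (Z p) + g p (Y p) (nabla X Z p)"
proof -
  have "field_deriv M X (\<lambda>q. g q (Y q) (Z q)) p
    = g p (nabla X Y p) (Z p) + g p (Y p) (nabla X Z p)"
    using levi_civita U assms unfolding levi_civita_def by blast
  then show ?thesis by (simp add: field_deriv_def)
qed

text \<open>Locality in the first slot is built in: \<open>W\<close> need agree with \<open>X - Y\<close> on \<open>U\<close> only.  This is
needed for \<open>W\<close> a Lie bracket, which the torsion-free property identifies only on the open set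
where the fields are smooth.\<close>

lemma nabla_diff_left:
  assumes X: "smooth_field M U X" and Y: "smooth_field M U Y" and Z: "smooth_field M U Z"
    and p: "p \<in> U" and W: "\<And>q. q \<in> U \<Longrightarrow> W q = X q - Y q"
  shows "nabla W Z p = nabla X Z p - nabla Y Z p"
proof -
  define D where "D q = W q - (X q - Y q)" for q
  (* The function f vanishes on U, hence is smooth there, and f D = D everywhere; so D drops out
     because the connection is linear over functions in its first argument. *)
  define f where "f q = (if q \<in> U then 0 else 1 :: real)" for q
  have f: "smooth_fun M U f"
    by (rule smooth_fun_cong[OF U smooth_fun_const[OF U, of 0]]) (simp add: f_def)
  have D: "smooth_field M U D"
    by (rule smooth_field_cong[OF U smooth_field_zero[OF U]]) (simp add: D_def W)
  have "D = (\<lambda>q. f q *\<^sub>R D q)" by (auto simp: D_def f_def W)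
  then have "nabla D Z p = nabla (\<lambda>q. f q *\<^sub>R D q) Z p" by simp
  also have "\<dots> = 0" using nabla_axioms(3)[OF D Z Z f p] p by (simp add: f_def)
  finally have D0: "nabla D Z p = 0" .
  have mY: "smooth_field M U (\<lambda>q. (-1) *\<^sub>R Y q)"
    by (rule smooth_field_scale[OF U smooth_fun_const[OF U] Y])
  have "W = (\<lambda>q. (X q + (-1) *\<^sub>R Y q) + D q)" by (auto simp: D_def)
  then have "nabla W Z p = nabla (\<lambda>q. (X q + (-1) *\<^sub>R Y q) + D q) Z p" by simp
  also have "\<dots> = nabla (\<lambda>q. X q + (-1) *\<^sub>R Y q) Z p + nabla D Z p"
    by (rule nabla_axioms(2)[OF smooth_field_add[OF U X mY] D Z f p])
  also have "nabla (\<lambda>q. X q + (-1) *\<^sub>R Y q) Z p = nabla X Z p + nabla (\<lambda>q. (-1) *\<^sub>R Y q) Z p"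
    by (rule nabla_axioms(2)[OF X mY Z f p])
  also have "nabla (\<lambda>q. (-1) *\<^sub>R Y q) Z p = (-1) *\<^sub>R nabla Y Z p"
    by (rule nabla_axioms(3)[OF Y Z Z smooth_fun_const[OF U] p])
  finally show ?thesis by (simp add: D0)
qed

text \<open>Metric compatibility turns \<open>g(\<nabla>\<^bsub>X\<^esub> G, Y)\<close> into \<open>X(Y f) - (\<nabla>\<^bsub>X\<^esub> Y) f\<close>, which is
symmetric because \<open>[X, Y] = \<nabla>\<^bsub>X\<^esub> Y - \<nabla>\<^bsub>Y\<^esub> X\<close>.\<close>

lemma hessian_symmetric:
  assumes e: "orthonormal_frame M g U e" and f: "smooth_fun M U f"
    and X: "smooth_field M U X" and Y: "smooth_field M U Y" and p: "p \<in> U"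
  shows "g p (nabla X (gradient M g f) p) (Y p) = g p (nabla Y (gradient M g f) p) (X p)"
proof -
  let ?G = "gradient M g f"
  have pM: "p \<in> points M" by (rule open_subset_points[OF U p])
  note G = smooth_gradient[OF f e] and grad = metric_gradient[OF f e]
  have second: "field_deriv M V (field_deriv M W f) p
      = g p (nabla V ?G p) (W p) + vec_deriv M p (nabla V W p) f"
    if V: "smooth_field M U V" and W: "smooth_field M U W" for V W
  proof -
    have "field_deriv M V (field_deriv M W f) p = vec_deriv M p (V p) (\<lambda>q. g q (?G q) (W q))"
      unfolding field_deriv_def[of M V]
      by (rule vec_deriv_cong[OF U p]) (simp add: grad field_deriv_def)
    then show ?thesis using metric_compatible[OF V G W p] grad[OF p] by simp
  qed
  have "vec_deriv M p (nabla X Y p - nabla Y X p) f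
      = vec_deriv M p (nabla X Y p) f - vec_deriv M p (nabla Y X p) f"
    by (rule linear_diff[OF linear_vec_deriv[OF U f p]])
  then show ?thesis
    using vec_deriv_lie_bracket[OF U f X Y p] torsion_free[OF X Y p] second[OF X Y] second[OF Y X]
    by simp
qed

end

end

section \<open>Conformal vector fields\<close>

text \<open>The equation \<open>conformal\<close> is \<open>L\<^bsub>\<xi>\<^esub> g = 2 \<sigma> g\<close> with the Lie derivative of the metric written
through the connection.\<close>

locale conformal_field = levi_civita_manifold M g nabla
  for M :: "('a, 'n::finite) mfd" and g :: "('a, 'n) metric_tensor" and nabla :: "('a, 'n) connection" +
  fixes \<xi> :: "('a, 'n) field" and \<sigma> :: "'a \<Rightarrow> real"
  assumes smooth_\<xi>_points: "smooth_field M (points M) \<xi>"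
    and conformal: "\<And>U X Y p. openin (mtop M) U \<Longrightarrow> smooth_field M U X \<Longrightarrow> smooth_field M U Y \<Longrightarrow>
      p \<in> U \<Longrightarrow> g p (nabla X \<xi> p) (Y p) + g p (X p) (nabla Y \<xi> p) = 2 * \<sigma> p * g p (X p) (Y p)"
begin

lemma smooth_\<xi>: "openin (mtop M) U \<Longrightarrow> smooth_field M U \<xi>"
  using smooth_field_subset[OF smooth_\<xi>_points] openin_subset by blast

lemma conformal_diagonal:
  assumes "openin (mtop M) U" "smooth_field M U X" "p \<in> U"
  shows "g p (nabla X \<xi> p) (X p) = \<sigma> p * g p (X p) (X p)"
  using conformal[OF assms(1,2,2,3)] metric_sym[OF open_subset_points[OF assms(1,3)], of "X p" "nabla X \<xi> p"] by simp

text \<open>On a unit field the conformal equation expresses \<open>\<sigma>\<close> through the metric and the connection,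
which preserve smoothness.\<close>

lemma smooth_conformal_factor:
  assumes U: "openin (mtop M) U" and E: "smooth_field M U E"
    and unit: "\<And>p. p \<in> U \<Longrightarrow> g p (E p) (E p) = 1"
  shows "smooth_fun M U \<sigma>"
  by (rule smooth_fun_cong[OF U smooth_metric[OF U smooth_nabla[OF U E smooth_\<xi>[OF U]] E]])
    (simp add: conformal_diagonal[OF U E] unit)

lemma smooth_factor_on_frame:
  assumes "orthonormal_frame M g U e"
  shows "smooth_fun M U \<sigma>"
  by (rule smooth_conformal_factor[of U "e undefined"])
    (use assms in \<open>auto simp: orthonormal_frame_def\<close>)

text \<open>The iterated derivatives in \<open>g(R(E, \<xi>) \<xi>, E)\<close> are computed by metric compatibility; the conformal
equation serves to move \<open>\<nabla> \<xi>\<close> from one argument of the metric to the other.  The terms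
\<open>|\<nabla>\<^bsub>E\<^esub> \<xi>|\<^sup>2\<close> and \<open>2 \<sigma>\<^sup>2\<close>, which come from \<open>\<nabla>\<^bsub>E\<^esub> \<nabla>\<^bsub>\<xi>\<^esub> \<xi>\<close> and from
\<open>\<nabla>\<^bsub>[E, \<xi>]\<^esub> \<xi>\<close>, cancel.\<close>

lemma curvature_plus_second_derivative:
  assumes U: "openin (mtop M) U" and E: "smooth_field M U E"
    and unit: "\<And>p. p \<in> U \<Longrightarrow> g p (E p) (E p) = 1" and p: "p \<in> U"
  shows "g p (curvature M nabla E \<xi> \<xi> p) (E p)
      + g p (nabla E (nabla E \<xi>) p - nabla (nabla E E) \<xi> p) (\<xi> p)
    = 2 * vec_deriv M p (E p) \<sigma> * g p (\<xi> p) (E p) - vec_deriv M p (\<xi> p) \<sigma>"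
proof -
  have pM: "p \<in> points M" by (rule open_subset_points[OF U p])
  note \<xi> = smooth_\<xi>[OF U] and N = smooth_nabla[OF U] and sym = metric_sym[OF pM]
    and s\<sigma> = smooth_conformal_factor[OF U E unit]
  note smooth = \<xi> E N[OF E \<xi>] N[OF \<xi> \<xi>] N[OF E E] N[OF \<xi> E]
  (* The term with \<nabla>\<^bsub>\<xi>\<^esub> \<nabla>\<^bsub>E\<^esub> \<xi>, from differentiating g(\<nabla>\<^bsub>E\<^esub> \<xi>, E) = \<sigma> along \<xi>. *)
  have "vec_deriv M p (\<xi> p) \<sigma> = vec_deriv M p (\<xi> p) (\<lambda>q. g q (nabla E \<xi> q) (E q))"
    by (rule vec_deriv_cong[OF U p]) (simp add: conformal_diagonal[OF U E] unit)
  also have "\<dots> = g p (nabla \<xi> (nabla E \<xi>) p) (E p) + g p (nabla E \<xi> p) (nabla \<xi> E p)"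
    by (rule metric_compatible[OF U \<xi> N[OF E \<xi>] E p])
  finally have 1: "vec_deriv M p (\<xi> p) \<sigma>
      = g p (nabla \<xi> (nabla E \<xi>) p) (E p) + g p (nabla E \<xi> p) (nabla \<xi> E p)" .
  (* The term with \<nabla>\<^bsub>E\<^esub> \<nabla>\<^bsub>\<xi>\<^esub> \<xi>, from differentiating along E the conformal equation
     g(\<nabla>\<^bsub>\<xi>\<^esub> \<xi>, E) = 2 \<sigma> g(\<xi>, E) - g(\<xi>, \<nabla>\<^bsub>E\<^esub> \<xi>). *)
  have "g p (nabla E (nabla \<xi> \<xi>) p) (E p) + g p (nabla \<xi> \<xi> p) (nabla E E p)
      = vec_deriv M p (E p) (\<lambda>q. g q (nabla \<xi> \<xi> q) (E q))"
    by (rule metric_compatible[OF U E N[OF \<xi> \<xi>] E p, symmetric])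
  also have "\<dots> = vec_deriv M p (E p)
      (\<lambda>q. 2 * (\<sigma> q * g q (\<xi> q) (E q)) + (- 1) * g q (\<xi> q) (nabla E \<xi> q))"
    by (rule vec_deriv_cong[OF U p]) (use conformal[OF U \<xi> E] in \<open>simp add: algebra_simps eq_diff_eq\<close>)
  also have "\<dots> = 2 * (\<sigma> p * vec_deriv M p (E p) (\<lambda>q. g q (\<xi> q) (E q))
        + vec_deriv M p (E p) \<sigma> * g p (\<xi> p) (E p))
      - vec_deriv M p (E p) (\<lambda>q. g q (\<xi> q) (nabla E \<xi> q))"
  proof -
    note m1 = smooth_metric[OF U \<xi> E] and m2 = smooth_metric[OF U \<xi> N[OF E \<xi>]]
    note c1 = smooth_fun_const[OF U, of 2] and c2 = smooth_fun_const[OF U, of "-1"]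
    note m3 = smooth_fun_mult[OF U s\<sigma> m1]
    show ?thesis
      using vec_deriv_add[OF U smooth_fun_mult[OF U c1 m3] smooth_fun_mult[OF U c2 m2] p, of "E p"]
        vec_deriv_mult[OF U c1 m3 p, of "E p"] vec_deriv_mult[OF U c2 m2 p, of "E p"]
        vec_deriv_mult[OF U s\<sigma> m1 p, of "E p"] vec_deriv_const[OF U] by simp
  qed
  also have "vec_deriv M p (E p) (\<lambda>q. g q (\<xi> q) (E q))
      = g p (nabla E \<xi> p) (E p) + g p (\<xi> p) (nabla E E p)"
    by (rule metric_compatible[OF U E \<xi> E p])
  also have "vec_deriv M p (E p) (\<lambda>q. g q (\<xi> q) (nabla E \<xi> q))
      = g p (nabla E \<xi> p) (nabla E \<xi> p) + g p (\<xi> p) (nabla E (nabla E \<xi>) p)"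
    by (rule metric_compatible[OF U E \<xi> N[OF E \<xi>] p])
  finally have 2: "g p (nabla E (nabla \<xi> \<xi>) p) (E p) + g p (nabla \<xi> \<xi> p) (nabla E E p)
      = 2 * (\<sigma> p * (g p (nabla E \<xi> p) (E p) + g p (\<xi> p) (nabla E E p))
        + vec_deriv M p (E p) \<sigma> * g p (\<xi> p) (E p))
      - (g p (nabla E \<xi> p) (nabla E \<xi> p) + g p (\<xi> p) (nabla E (nabla E \<xi>) p))" .
  have 3: "g p (nabla \<xi> \<xi> p) (nabla E E p) + g p (\<xi> p) (nabla (nabla E E) \<xi> p)
      = 2 * \<sigma> p * g p (\<xi> p) (nabla E E p)"
    by (rule conformal[OF U \<xi> N[OF E E] p])
  (* The term with [E, \<xi>] = \<nabla>\<^bsub>E\<^esub> \<xi> - \<nabla>\<^bsub>\<xi>\<^esub> E. *)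
  have 4: "g p (nabla (nabla E \<xi>) \<xi> p) (E p) + g p (nabla E \<xi> p) (nabla E \<xi> p)
      = 2 * \<sigma> p * g p (nabla E \<xi> p) (E p)"
    by (rule conformal[OF U N[OF E \<xi>] E p])
  have 5: "g p (nabla (nabla \<xi> E) \<xi> p) (E p) + g p (nabla \<xi> E p) (nabla E \<xi> p)
      = 2 * \<sigma> p * g p (nabla \<xi> E p) (E p)"
    by (rule conformal[OF U N[OF \<xi> E] E p])
  have 6: "g p (nabla E \<xi> p) (E p) = \<sigma> p"
    using conformal_diagonal[OF U E p] unit[OF p] by simp
  have "vec_deriv M p (\<xi> p) (\<lambda>q. g q (E q) (E q)) = vec_deriv M p (\<xi> p) (\<lambda>q. 1)"
    by (rule vec_deriv_cong[OF U p]) (rule unit)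
  then have 7: "g p (nabla \<xi> E p) (E p) = 0"
    using metric_compatible[OF U \<xi> E E p] sym[of "E p" "nabla \<xi> E p"] vec_deriv_const[OF U] by simp
  have 8: "nabla (lie_bracket M E \<xi>) \<xi> p = nabla (nabla E \<xi>) \<xi> p - nabla (nabla \<xi> E) \<xi> p"
    by (rule nabla_diff_left[OF U N[OF E \<xi>] N[OF \<xi> E] \<xi> p torsion_free[OF U E \<xi>]])
  show ?thesis
    using 1 2 3 4 5 sym[of "\<xi> p" "nabla E (nabla E \<xi>) p"] sym[of "\<xi> p" "nabla (nabla E E) \<xi> p"]
      sym[of "nabla \<xi> E p" "nabla E \<xi> p"]
    unfolding curvature_def metric_simps[OF pM] 6 7 8
    by (simp add: algebra_simps)
qed

text \<open>The sum over an orthonormal frame of the identity for unit fields: the terms \<open>2 E(\<sigma>) g(\<xi>, E)\<close>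
add up to \<open>2 \<xi>(\<sigma>)\<close> and the terms \<open>- \<xi>(\<sigma>)\<close> to \<open>- n \<xi>(\<sigma>)\<close>.\<close>

lemma ricci_plus_laplacian:
  assumes pM: "p \<in> points M"
  shows "ricci M g nabla \<xi> \<xi> p + g p (laplacian M g nabla \<xi> p) (\<xi> p)
    = - (real CARD('n) - 2) * vec_deriv M p (\<xi> p) \<sigma>"
proof -
  let ?e = "frame_at M g p"
  obtain U where p: "p \<in> U" and e: "orthonormal_frame M g U ?e"
    by (rule orthonormal_frame_at[OF pM])
  have U: "openin (mtop M) U" and se: "\<And>i. smooth_field M U (?e i)"
    and orth: "\<And>q i j. q \<in> U \<Longrightarrow> g q (?e i q) (?e j q) = (if i = j then 1 else 0)"
    using e by (auto simp: orthonormal_frame_def)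
  note s\<sigma> = smooth_factor_on_frame[OF e]
  note D = linear_vec_deriv[OF U s\<sigma> p]
  have "vec_deriv M p (\<Sum>i\<in>UNIV. g p (\<xi> p) (?e i p) *\<^sub>R ?e i p) \<sigma>
      = (\<Sum>i\<in>UNIV. vec_deriv M p (?e i p) \<sigma> * g p (\<xi> p) (?e i p))"
    using linear_sum[OF D, of "\<lambda>i. g p (\<xi> p) (?e i p) *\<^sub>R ?e i p" UNIV]
    by (simp add: linear_scale[OF D] mult.commute)
  then have trace: "(\<Sum>i\<in>UNIV. vec_deriv M p (?e i p) \<sigma> * g p (\<xi> p) (?e i p)) = vec_deriv M p (\<xi> p) \<sigma>"
    unfolding orthonormal_expansion[OF pM orth[OF p], symmetric] by (rule sym)
  have "ricci M g nabla \<xi> \<xi> p + g p (laplacian M g nabla \<xi> p) (\<xi> p)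
    = (\<Sum>i\<in>UNIV. g p (curvature M nabla (?e i) \<xi> \<xi> p) (?e i p)
        + g p (nabla (?e i) (nabla (?e i) \<xi>) p - nabla (nabla (?e i) (?e i)) \<xi> p) (\<xi> p))"
    by (simp add: ricci_def laplacian_def Let_def metric_simps(9)[OF pM] sum.distrib)
  also have "\<dots> = (\<Sum>i\<in>UNIV. 2 * vec_deriv M p (?e i p) \<sigma> * g p (\<xi> p) (?e i p) - vec_deriv M p (\<xi> p) \<sigma>)"
    by (intro sum.cong refl curvature_plus_second_derivative[OF U se _ p]) (simp add: orth)
  also have "\<dots> = 2 * vec_deriv M p (\<xi> p) \<sigma> - real CARD('n) * vec_deriv M p (\<xi> p) \<sigma>"
    by (simp add: sum_subtractf trace[symmetric] sum_distrib_left mult.assoc)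
  finally show ?thesis by (simp add: algebra_simps)
qed

text \<open>Differentiating the relation between \<open>\<xi>(\<sigma>)\<close> and \<open>|\<xi>|\<^sup>2\<close> along \<open>\<xi>\<close> and along the gradient of
\<open>\<sigma>\<close> gives two equations which, combined with the conformal equation for this pair of fields,
force \<open>\<sigma> |grad \<sigma>|\<^sup>2 = 0\<close>.\<close>

lemma factor_times_gradient_zero:
  assumes n: "c \<noteq> 0"
    and hess: "\<And>p. p \<in> points M \<Longrightarrow> nabla \<xi> (gradient M g \<sigma>) p = 0"
    and scaled_deriv: "\<And>p. p \<in> points M \<Longrightarrow> c * vec_deriv M p (\<xi> p) \<sigma> = \<kappa> * g p (\<xi> p) (\<xi> p)"
    and pM: "p \<in> points M"
  shows "\<sigma> p * vec_deriv M p v \<sigma> = 0"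
proof -
  obtain U where p: "p \<in> U" and e: "orthonormal_frame M g U (frame_at M g p)"
    by (rule orthonormal_frame_at[OF pM])
  have U: "openin (mtop M) U" using e by (simp add: orthonormal_frame_def)
  note s\<sigma> = smooth_factor_on_frame[OF e]
  let ?G = "gradient M g \<sigma>"
  note \<xi> = smooth_\<xi>[OF U] and G = smooth_gradient[OF s\<sigma> e] and grad = metric_gradient[OF s\<sigma> e]
    and sym = metric_sym[OF pM]
  have deriv: "c * g p (nabla X \<xi> p) (?G p) = 2 * \<kappa> * g p (nabla X \<xi> p) (\<xi> p)"
    if X: "smooth_field M U X" for X
  proof -
    have "vec_deriv M p (X p) (\<lambda>q. g q (?G q) (\<xi> q)) = g p (nabla X ?G p) (\<xi> p) + g p (?G p) (nabla X \<xi> p)"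
      by (rule metric_compatible[OF U X G \<xi> p])
    also have "g p (nabla X ?G p) (\<xi> p) = g p (nabla \<xi> ?G p) (X p)"
      by (rule hessian_symmetric[OF U e s\<sigma> X \<xi> p])
    finally have 1: "vec_deriv M p (X p) (\<lambda>q. g q (?G q) (\<xi> q)) = g p (nabla X \<xi> p) (?G p)"
      using hess[OF pM] sym[of "?G p" "nabla X \<xi> p"] by (simp add: metric_simps[OF pM])
    have 2: "vec_deriv M p (X p) (\<lambda>q. g q (\<xi> q) (\<xi> q)) = 2 * g p (nabla X \<xi> p) (\<xi> p)"
      using metric_compatible[OF U X \<xi> \<xi> p] sym[of "\<xi> p" "nabla X \<xi> p"] by simp
    have "vec_deriv M p (X p) (\<lambda>q. c * g q (?G q) (\<xi> q)) = vec_deriv M p (X p) (\<lambda>q. \<kappa> * g q (\<xi> q) (\<xi> q))"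
      by (rule vec_deriv_cong[OF U p]) (use scaled_deriv[OF open_subset_points[OF U]] in \<open>simp add: grad\<close>)
    then show ?thesis
      unfolding vec_deriv_mult[OF U smooth_fun_const[OF U] smooth_metric[OF U G \<xi>] p]
        vec_deriv_mult[OF U smooth_fun_const[OF U] smooth_metric[OF U \<xi> \<xi>] p] vec_deriv_const[OF U] 1 2
      by simp
  qed
  have "c * g p (nabla \<xi> \<xi> p) (?G p) = 2 * \<sigma> p * (\<kappa> * g p (\<xi> p) (\<xi> p))"
    using deriv[OF \<xi>] conformal_diagonal[OF U \<xi> p] by simp
  also have "\<dots> = c * (2 * \<sigma> p * g p (\<xi> p) (?G p))"
    using scaled_deriv[OF pM] grad[OF p, of "\<xi> p"] sym[of "\<xi> p" "?G p"] by simp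
  finally have "g p (nabla \<xi> \<xi> p) (?G p) = 2 * \<sigma> p * g p (\<xi> p) (?G p)" using n by simp
  then have "g p (nabla ?G \<xi> p) (\<xi> p) = 0"
    using conformal[OF U \<xi> G p] sym[of "\<xi> p" "nabla ?G \<xi> p"] by simp
  then have "\<sigma> p * g p (?G p) (?G p) = 0"
    using deriv[OF G] conformal_diagonal[OF U G p] n by simp
  then have "\<sigma> p = 0 \<or> ?G p = 0" using metric_pos[OF pM, of "?G p"] by force
  then show ?thesis using grad[OF p, of v] by (auto simp: metric_simps[OF pM])
qed

lemma locally_smooth_factor:
  assumes "p \<in> points M"
  shows "\<exists>U. openin (mtop M) U \<and> p \<in> U \<and> smooth_fun M U \<sigma>"
proof -
  obtain U where p: "p \<in> U" and e: "orthonormal_frame M g U (frame_at M g p)"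
    by (rule orthonormal_frame_at[OF assms])
  have U: "openin (mtop M) U" using e by (simp add: orthonormal_frame_def)
  then show ?thesis using smooth_factor_on_frame[OF e] p by blast
qed

text \<open>The derivative of \<open>\<sigma>\<^sup>2\<close> is twice \<open>\<sigma>\<close> times that of \<open>\<sigma>\<close>, which is zero
by hypothesis, so \<open>\<sigma>\<^sup>2\<close> is constant.  Hence a
single zero of \<open>\<sigma>\<close> makes it vanish everywhere, and if there is none its derivative vanishes.\<close>

lemma constant_factor:
  assumes conn: "connected_space (mtop M)"
    and zero: "\<And>p v. p \<in> points M \<Longrightarrow> \<sigma> p * vec_deriv M p v \<sigma> = 0"
    and pq: "p \<in> points M" "q \<in> points M"
  shows "\<sigma> p = \<sigma> q"
proof -
  have sq: "\<sigma> r * \<sigma> r = \<sigma> s * \<sigma> s" if "r \<in> points M" "s \<in> points M" for r s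
  proof (rule constant_of_vec_deriv_zero[OF conn _ _ that])
    fix t assume t: "t \<in> points M"
    obtain U where U: "openin (mtop M) U" "t \<in> U" "smooth_fun M U \<sigma>"
      using locally_smooth_factor[OF t] by blast
    show "\<exists>U. openin (mtop M) U \<and> t \<in> U \<and> smooth_fun M U (\<lambda>r. \<sigma> r * \<sigma> r)"
      using U smooth_fun_mult[OF U(1,3,3)] by blast
    show "vec_deriv M t v (\<lambda>r. \<sigma> r * \<sigma> r) = 0" for v
      using vec_deriv_mult[OF U(1,3,3,2)] zero[OF t, of v] by (simp add: mult.commute)
  qed
  show ?thesis
  proof (cases "\<exists>r\<in>points M. \<sigma> r = 0")
    case True
    then obtain r where "r \<in> points M" "\<sigma> r = 0" by blast
    then show ?thesis using sq[OF pq(1), of r] sq[OF pq(2), of r] by simp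
  next
    case False
    then show ?thesis
      using zero by (intro constant_of_vec_deriv_zero[OF conn locally_smooth_factor _ pq]) auto
  qed
qed

end

section \<open>Yamabe solitons\<close>

theorem theorem3p2:
  fixes M :: "('a, 'n::finite) mfd"
    and g :: "('a, 'n) metric_tensor"
    and nabla :: "('a, 'n) connection"
    and \<xi> :: "('a, 'n) field"
    and lam \<mu> \<nu> :: real
  assumes "CARD('n) > 2"
    and "yamabe_soliton M g nabla \<xi> lam"
    and "\<forall>p\<in>points M. hessian_operator M g nabla (scalar_curvature M g nabla) \<xi> p = 0"
    and "\<mu> > 0"
    and "\<forall>p\<in>points M. laplacian M g nabla \<xi> p = - \<mu> *\<^sub>R \<xi> p"
    and "\<forall>p\<in>points M. ricci M g nabla \<xi> \<xi> p = \<nu> * g p (\<xi> p) (\<xi> p)"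
  shows "yamabe_metric M g nabla"
proof -
  let ?R = "scalar_curvature M g nabla"
  define \<sigma> where "\<sigma> p = ?R p - lam" for p
  note soliton = assms(2)[unfolded yamabe_soliton_def]
  have conn: "connected_space (mtop M)" using soliton by blast
  interpret levi_civita_manifold M g nabla
    using soliton by unfold_locales auto
  have s\<xi>: "smooth_field M (points M) \<xi>" using soliton by blast
  interpret conformal_field M g nabla \<xi> \<sigma>
  proof unfold_locales
    fix U X Y p
    assume U: "openin (mtop M) U" and X: "smooth_field M U X" and Y: "smooth_field M U Y" and p: "p \<in> U"
    have pM: "p \<in> points M" by (rule open_subset_points[OF U p])
    have \<xi>: "smooth_field M U \<xi>"
      using smooth_field_subset[OF s\<xi>] openin_subset[OF U] by blast
    have "lie_deriv_metric M \<xi> g X Y p = g p (nabla X \<xi> p) (Y p) + g p (X p) (nabla Y \<xi> p)"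
      unfolding lie_deriv_metric_def field_deriv_def metric_compatible[OF U \<xi> X Y p]
        torsion_free[OF U \<xi> X p] torsion_free[OF U \<xi> Y p] metric_simps[OF pM] by simp
    moreover have "1/2 * lie_deriv_metric M \<xi> g X Y p = (?R p - lam) * g p (X p) (Y p)"
      using soliton U X Y p by blast
    ultimately show "g p (nabla X \<xi> p) (Y p) + g p (X p) (nabla Y \<xi> p) = 2 * \<sigma> p * g p (X p) (Y p)"
      by (simp add: \<sigma>_def)
  qed (rule s\<xi>)
  have "\<sigma> = (\<lambda>p. ?R p - lam)" by (rule ext) (rule \<sigma>_def)
  then have "gradient M g \<sigma> = gradient M g ?R"
    by (simp add: gradient_def[abs_def] vec_deriv_diff_const)
  then have hess: "nabla \<xi> (gradient M g \<sigma>) p = 0" if "p \<in> points M" for p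
    using assms(3) that by (simp add: hessian_operator_def)
  (* The Laplacian contributes - \<mu> |\<xi>|^2 and the Ricci curvature \<nu> |\<xi>|^2. *)
  have scaled_deriv: "(real CARD('n) - 2) * vec_deriv M p (\<xi> p) \<sigma> = (\<mu> - \<nu>) * g p (\<xi> p) (\<xi> p)"
    if p: "p \<in> points M" for p
    using ricci_plus_laplacian[OF p] assms(5,6) p metric_simps(5)[OF p, of "- \<mu>" "\<xi> p" "\<xi> p"]
    by (simp add: algebra_simps)
  have "real CARD('n) - 2 \<noteq> 0" using assms(1) by simp
  note zero = factor_times_gradient_zero[OF this hess scaled_deriv]
  have "?R p = ?R q" if "p \<in> points M" "q \<in> points M" for p q
    using constant_factor[OF conn zero that] by (simp add: \<sigma>_def)
  then show ?thesis unfolding yamabe_metric_def constant_on_def by blast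
qed

end
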